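(* Let $A$ be the $n\times n$ identity matrix and let $d$ be a constant. Let $\{\rho_{ij}\}_{1\le i,j\le n}$ be independent random $d\times d$ complex matrices, let $M$ be the $n\times n$ matrix with entries $M_{ij}=\rho_{ij}A_{ij}$, and let $X_s=\lvert\operatorname{tr}\operatorname{sdet}M\rvert^2$. Then \[ \frac{\mathbb{E}[X_s^2]}{\mathbb{E}[X_s]^2}=\Omega\!\left(\frac{2^n}{n^d}\right) \] when the $\rho_{ij}$ are distributed according to the Gaussian measure, and \[ \frac{\mathbb{E}[X_s^2]}{\mathbb{E}[X_s]^2}=\left(1-O\!\left(\frac1d\right)\right)^n\Omega\!\left(\frac{2^n}{n^d}\right) \] when they are distributed according to the Haar measure.
   Context: The Haar measure is the uniform (Haar) probability distribution on the unitary group $\mathsf{U}(d)$. In the Gaussian measure, each entry of the $d\times d$ matrix is drawn independently from the complex Gaussian distribution with mean $0$ and variance $1/d$ (real and imaginary parts independent real Gaussians with mean $0$ and variance $1/(2d)$). For an $n\times n$ matrix $M$ whose entries are $d\times d$ complex matrices, the symmetrized determinant is $\operatorname{sdet}M=\frac{1}{n!}\sum_{\alpha,\alpha'\in S_n}(-1)^{\alpha'\alpha^{-1}}\prod_{i=1}^n M_{\alpha i,\alpha' i}$, where $(-1)^\pi$ is the sign of the permutation $\pi$ and the product is taken in the order $i=1,\dots,n$ (left to right); it is a $d\times d$ matrix, and $\operatorname{tr}$ is the matrix trace. *)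

theory Defs
  imports
    "HOL-Probability.Probability"
    "HOL-Combinatorics.Permutations"
    "HOL-Library.Landau_Symbols"
    "Jordan_Normal_Form.Schur_Decomposition"
begin

text \<open>The dimension \<open>d\<close> and the size \<open>n\<close> vary inside the statement, so matrices are the
  dimension-free ones of \<^theory>\<open>Jordan_Normal_Form.Matrix\<close>.
  An \<open>n \<times> n\<close> matrix over \<open>d \<times> d\<close> matrices is a function on index pairs;
  indices start at 0.\<close>

definition mat_trace :: "complex mat \<Rightarrow> complex" where
  "mat_trace B = (\<Sum>a<dim_row B. B $$ (a, a))"

text \<open>The product \<open>B 0 * B 1 * \<dots> * B (n - 1)\<close>, in this order, of \<open>d \<times> d\<close> matrices.\<close>

definition ordered_prod :: "nat \<Rightarrow> nat \<Rightarrow> (nat \<Rightarrow> complex mat) \<Rightarrow> complex mat" where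
  "ordered_prod d n B = foldr (\<lambda>i C. B i * C) [0..<n] (1\<^sub>m d)"

text \<open>The type of matrices of unspecified dimension has no global zero, hence the sum over
  permutations is taken entrywise.\<close>

definition sdet :: "nat \<Rightarrow> nat \<Rightarrow> (nat \<times> nat \<Rightarrow> complex mat) \<Rightarrow> complex mat" where
  "sdet d n M = mat d d (\<lambda>ab.
     1 / fact n *
     (\<Sum>\<alpha> | \<alpha> permutes {..<n}. \<Sum>\<alpha>' | \<alpha>' permutes {..<n}.
        of_int (sign (\<alpha>' \<circ> inv_into UNIV \<alpha>)) * ordered_prod d n (\<lambda>i. M (\<alpha> i, \<alpha>' i)) $$ ab))"

definition X_s :: "nat \<Rightarrow> nat \<Rightarrow> complex mat \<Rightarrow> (nat \<times> nat \<Rightarrow> complex mat) \<Rightarrow> real" where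
  "X_s d n A R = (cmod (mat_trace (sdet d n (\<lambda>ij. A $$ ij \<cdot>\<^sub>m R ij))))\<^sup>2"

text \<open>The Borel \<open>\<sigma>\<close>-algebra on \<open>d \<times> d\<close> complex matrices, i.e. the one generated by the entries.\<close>

definition borel_mat :: "nat \<Rightarrow> complex mat measure" where
  "borel_mat d = vimage_algebra (carrier_mat d d)
     (\<lambda>B. \<lambda>ij\<in>{..<d} \<times> {..<d}. B $$ ij) (\<Pi>\<^sub>M ij\<in>{..<d} \<times> {..<d}. (borel :: complex measure))"

text \<open>The complex Gaussian of mean 0 and variance \<open>v\<close>; note that \<^const>\<open>normal_density\<close> takes
  the standard deviation.\<close>

definition complex_gaussian :: "real \<Rightarrow> complex measure" where
  "complex_gaussian v =
     (let N = density lborel (\<lambda>x. ennreal (normal_density 0 (sqrt (v / 2)) x))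
      in distr (N \<Otimes>\<^sub>M N) borel (\<lambda>(x, y). Complex x y))"

definition gaussian_mat :: "nat \<Rightarrow> complex mat measure" where
  "gaussian_mat d = distr (\<Pi>\<^sub>M ij\<in>{..<d} \<times> {..<d}. complex_gaussian (1 / real d))
     (borel_mat d) (\<lambda>f. mat d d f)"

definition unitary_group :: "nat \<Rightarrow> complex mat set" where
  "unitary_group d = {U \<in> carrier_mat d d. mat_adjoint U * U = 1\<^sub>m d \<and> U * mat_adjoint U = 1\<^sub>m d}"

text \<open>\<open>\<mu>\<close> is the Haar probability measure: the (unique) left-invariant Borel probability measure on
  the unitary group.\<close>

definition haar_unitary :: "nat \<Rightarrow> complex mat measure \<Rightarrow> bool" where
  "haar_unitary d \<mu> \<longleftrightarrow>
     prob_space \<mu> \<and> space \<mu> = unitary_group d \<and>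
     sets \<mu> = sets (restrict_space (borel_mat d) (unitary_group d)) \<and>
     (\<forall>V\<in>unitary_group d. distr \<mu> \<mu> (\<lambda>U. V * U) = \<mu>)"

definition iid_matrices ::
    "'a measure \<Rightarrow> complex mat measure \<Rightarrow> nat \<Rightarrow> (nat \<times> nat \<Rightarrow> 'a \<Rightarrow> complex mat) \<Rightarrow> bool" where
  "iid_matrices P \<mu> n \<rho> \<longleftrightarrow>
     prob_space P \<and>
     prob_space.indep_vars P (\<lambda>_. \<mu>) \<rho> ({..<n} \<times> {..<n}) \<and>
     (\<forall>ij\<in>{..<n} \<times> {..<n}. distr P \<mu> (\<rho> ij) = \<mu>)"

definition moment_ratio ::
    "'a measure \<Rightarrow> nat \<Rightarrow> nat \<Rightarrow> complex mat \<Rightarrow> (nat \<times> nat \<Rightarrow> 'a \<Rightarrow> complex mat) \<Rightarrow> real" where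
  "moment_ratio P d n A \<rho> =
     (\<integral>\<omega>. (X_s d n A (\<lambda>ij. \<rho> ij \<omega>))\<^sup>2 \<partial>P) / (\<integral>\<omega>. X_s d n A (\<lambda>ij. \<rho> ij \<omega>) \<partial>P)\<^sup>2"

end

theory Submission
  imports Defs "HOL-Combinatorics.Multiset_Permutations"
begin

text \<open>
  Since \<open>A\<close> is the identity, only the terms \<open>\<alpha> = \<alpha>'\<close> of the symmetrized determinant survive, and
  with \<open>U\<^sub>j = \<rho>\<^sub>j\<^sub>j\<close> its trace is \<open>T = 1/n! \<Sum>\<^sub>\<alpha> \<Sum>\<^sub>w \<Prod>\<^sub>i U\<^bsub>\<alpha> i\<^esub>(w i, w (i + 1))\<close>, where \<open>w\<close> runs over
  the closed walks of length \<open>n\<close> on \<open>d\<close> vertices.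

  Upper bound for \<open>E|T|\<^sup>2\<close>. As the entries are uncorrelated with variance \<open>1/d\<close>, it is \<open>d\<^sup>-\<^sup>n/n!\<^sup>2\<close> times the
  number of pairs \<open>((\<alpha>, w), (\<alpha>', w'))\<close> that give every index \<open>j\<close> the same edge. For fixed \<open>(\<alpha>, w)\<close> the second
  pair amounts to an Eulerian circuit, which is determined by its starting vertex and an ordering of the
  edges leaving each vertex \<open>u\<close>; hence there are at most \<open>d \<Prod>\<^sub>u k\<^sub>u!\<close> of them, \<open>k\<^sub>u\<close> being the number of
  visits of \<open>w\<close> to \<open>u\<close>. Summing \<open>\<Prod>\<^sub>u k\<^sub>u!\<close> over all vertex sequences gives \<open>d (d + 1) \<dots> (d + n - 1)\<close>, so
  \<open>E|T|\<^sup>2 = O(n\<^bsup>d - 1\<^esup>/d\<^sup>n)\<close>.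

  Lower bound for \<open>E|T|\<^sup>4\<close>. By Cauchy-Schwarz it is at least \<open>|E(T\<^sup>2 G\<^sup>*)|\<^sup>2 / E|G|\<^sup>2\<close> for
  \<open>G = \<Sum>\<^sub>v \<Prod>\<^sub>j (v\<^sup>* U\<^sub>j v)\<^sup>2\<close>, where \<open>v\<close> runs over a family of about \<open>n\<^bsup>d - 1\<^esup>\<close> unit vectors at mutual distance
  about \<open>n\<^bsup>-1/2\<^esup>\<close>. Both ensembles satisfy \<open>E(U\<^sub>p U\<^sub>q (v\<^sup>* U v)\<^sup>2\<^sup>*) = \<kappa> V\<^sub>p V\<^sub>q\<close> with \<open>V = v v\<^sup>*\<close>, so the numerator is the
  square of \<open>\<kappa>\<^sup>n\<close> times the size of the family, while \<open>E|G|\<^sup>2\<close> is \<open>\<kappa>\<^sup>n\<close> times the sum of all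
  \<open>|\<langle>v, w\<rangle>|\<^bsup>4 n\<^esup>\<close>, which is comparable to the size of the family. The resulting bound for the ratio is
  \<open>(\<kappa> d\<^sup>2)\<^sup>n/n\<^bsup>d - 1\<^esup>\<close> up to a constant, with \<open>\<kappa> d\<^sup>2 = 2\<close> for Gaussian matrices
  and \<open>\<kappa> d\<^sup>2 = 2 (1 - 1/(d + 1))\<close> for Haar unitaries.
\<close>

section \<open>Closed walks and their rearrangements\<close>

lemma sum_PiE_lessThan_Suc:
  "(\<Sum>f\<in>PiE {..<Suc n} A. F f) = (\<Sum>x\<in>A n. \<Sum>g\<in>PiE {..<n} A. F (g(n := x)))"
proof -
  have "PiE {..<Suc n} A = (\<lambda>(y, g). g(n := y)) ` (A n \<times> PiE {..<n} A)"
    by (simp add: lessThan_Suc PiE_insert_eq)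
  moreover have "inj_on (\<lambda>(y, g). g(n := y)) (A n \<times> PiE {..<n} A)"
    by (rule inj_combinator) auto
  ultimately show ?thesis
    by (simp add: sum.reindex sum.cartesian_product case_prod_unfold)
qed

lemma card_fibre_fun_upd:
  "card {i. i < Suc n \<and> (g(n := x)) i = u} = card {i. i < n \<and> g i = u} + (if u = x then 1 else 0)"
proof -
  have "{i. i < Suc n \<and> (g(n := x)) i = u} =
      (if u = x then insert n {i. i < n \<and> g i = u} else {i. i < n \<and> g i = u})"
    by (auto simp: less_Suc_eq)
  thus ?thesis by simp
qed

lemma sum_card_fibres:
  fixes d :: nat
  assumes "g \<in> PiE {..<n} (\<lambda>_. {..<d})"
  shows "(\<Sum>u<d. card {i. i < n \<and> g i = u}) = n"
proof -
  have "(\<Sum>u<d. card {i. i < n \<and> g i = u}) = card (\<Union>u<d. {i. i < n \<and> g i = u})"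
    by (subst card_UN_disjoint) auto
  also have "(\<Union>u<d. {i. i < n \<and> g i = u}) = {..<n}" using assms by (auto simp: PiE_iff)
  finally show ?thesis by simp
qed

text \<open>Appending the vertex x multiplies the weight by k_x + 1, where k_x counts the earlier
  visits to x. The k_x add up to n, so summing over x gives the factor n + d, which is the recursion
  of the rising factorial.\<close>

lemma sum_prod_fact_fibres:
  "(\<Sum>a\<in>PiE {..<n} (\<lambda>_. {..<d}). \<Prod>u<d. fact (card {i. i < n \<and> a i = u}) :: nat) = pochhammer d n"
proof (induction n)
  case (Suc n)
  have "(\<Sum>x<d. \<Prod>u<d. fact (card {i. i < Suc n \<and> (g(n := x)) i = u}) :: nat) =
      (n + d) * (\<Prod>u<d. fact (card {i. i < n \<and> g i = u}))"
    if g: "g \<in> PiE {..<n} (\<lambda>_. {..<d})" for g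
  proof -
    let ?k = "\<lambda>u. card {i. i < n \<and> g i = u}"
    have "(\<Prod>u<d. fact (card {i. i < Suc n \<and> (g(n := x)) i = u}) :: nat) =
        (?k x + 1) * (\<Prod>u<d. fact (?k u))" if x: "x < d" for x
    proof -
      have "(\<Prod>u<d. fact (card {i. i < Suc n \<and> (g(n := x)) i = u}) :: nat) =
          (\<Prod>u<d. fact (?k u) * (if u = x then ?k u + 1 else 1))"
        by (intro prod.cong refl) (auto simp del: fun_upd_apply simp: card_fibre_fun_upd)
      thus ?thesis using x by (simp add: prod.distrib prod.delta)
    qed
    hence "(\<Sum>x<d. \<Prod>u<d. fact (card {i. i < Suc n \<and> (g(n := x)) i = u}) :: nat) =
        (\<Sum>x<d. (?k x + 1) * (\<Prod>u<d. fact (?k u)))" by (intro sum.cong) auto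
    also have "\<dots> = ((\<Sum>x<d. ?k x) + d) * (\<Prod>u<d. fact (?k u))"
      by (simp add: sum_distrib_right[symmetric] sum.distrib algebra_simps)
    finally show ?thesis using sum_card_fibres[OF g] by simp
  qed
  hence "(\<Sum>g\<in>PiE {..<n} (\<lambda>_. {..<d}). \<Sum>x<d. \<Prod>u<d. fact (card {i. i < Suc n \<and> (g(n := x)) i = u}) :: nat)
     = (n + d) * pochhammer d n" by (simp add: Suc.IH[symmetric] sum_distrib_left del: fun_upd_apply)
  moreover have "(\<Sum>a\<in>PiE {..<Suc n} (\<lambda>_. {..<d}). \<Prod>u<d. fact (card {i. i < Suc n \<and> a i = u}) :: nat) =
     (\<Sum>g\<in>PiE {..<n} (\<lambda>_. {..<d}). \<Sum>x<d. \<Prod>u<d. fact (card {i. i < Suc n \<and> (g(n := x)) i = u}) :: nat)"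
    unfolding sum_PiE_lessThan_Suc by (rule sum.swap)
  ultimately show ?case by (simp only: pochhammer_Suc of_nat_id mult.commute add.commute)
qed simp

section \<open>Walks that use each edge of a directed multigraph once\<close>

fun is_walk :: "('a \<Rightarrow> 'b \<times> 'b) \<Rightarrow> 'b \<Rightarrow> 'a list \<Rightarrow> bool" where
  "is_walk e v [] \<longleftrightarrow> True"
| "is_walk e v (x # xs) \<longleftrightarrow> fst (e x) = v \<and> is_walk e (snd (e x)) xs"

text \<open>Elements of \<open>A\<close> are names of edges, so parallel edges stay distinct. A walk
  is determined by the order in which the edges leaving each vertex are used. In the induction the
  first edge is one of the k edges leaving v, and deleting it divides the factor k! at v by k; hence
  the k bounds for the remaining edges add up to the full product.\<close>

lemma card_walks_le:
  assumes "finite A" "finite D" "\<And>x. x \<in> A \<Longrightarrow> fst (e x) \<in> D"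
  shows "card {xs \<in> permutations_of_set A. is_walk e v xs} \<le> (\<Prod>u\<in>D. fact (card {x \<in> A. fst (e x) = u}))"
  using assms(1,3)
proof (induction "card A" arbitrary: A v)
  case 0
  hence "A = {}" by simp
  moreover have "{xs. xs = [] \<and> is_walk e v xs} = {[]}" by auto
  ultimately show ?case by simp
next
  case (Suc n)
  hence ne: "A \<noteq> {}" by auto
  let ?B = "{x \<in> A. fst (e x) = v}"
  let ?W = "\<lambda>A v. {xs \<in> permutations_of_set A. is_walk e v xs}"
  let ?P = "\<lambda>A. \<Prod>u\<in>D. fact (card {x \<in> A. fst (e x) = u}) :: nat"
  have fin: "finite A" by fact
  have eq: "?W A v = (\<Union>x\<in>?B. (#) x ` ?W (A - {x}) (snd (e x)))"
    using permutations_of_set_nonempty[OF ne] by auto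
  have "card (?W A v) \<le> (\<Sum>x\<in>?B. card ((#) x ` ?W (A - {x}) (snd (e x))))"
    unfolding eq by (rule card_UN_le) (use fin in auto)
  also have "\<dots> = (\<Sum>x\<in>?B. card (?W (A - {x}) (snd (e x))))"
    by (intro sum.cong refl card_image) (auto simp: inj_on_def)
  also have "\<dots> \<le> (\<Sum>x\<in>?B. ?P (A - {x}))"
    using Suc fin by (intro sum_mono Suc.hyps(1)) auto
  finally have le: "card (?W A v) \<le> (\<Sum>x\<in>?B. ?P (A - {x}))" .
  show ?case
  proof (cases "?B = {}")
    case True
    have "(\<Sum>x\<in>?B. ?P (A - {x})) = 0" unfolding True by simp
    with le show ?thesis by linarith
  next
    case False
    then obtain y where y: "y \<in> A" "fst (e y) = v" by auto
    hence vD: "v \<in> D" using Suc.prems(2) by auto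
    have P: "card ?B * ?P (A - {x}) = ?P A" if x: "x \<in> ?B" for x
    proof -
      have "?P (A - {x}) = fact (card {y \<in> A - {x}. fst (e y) = v}) *
          (\<Prod>u\<in>D - {v}. fact (card {y \<in> A - {x}. fst (e y) = u}))"
        by (subst prod.remove[OF assms(2) vD]) simp
      also have "{y \<in> A - {x}. fst (e y) = v} = ?B - {x}" by auto
      also have "(\<Prod>u\<in>D - {v}. fact (card {y \<in> A - {x}. fst (e y) = u}) :: nat) =
          (\<Prod>u\<in>D - {v}. fact (card {y \<in> A. fst (e y) = u}))"
        using x by (intro prod.cong refl arg_cong[of _ _ fact] arg_cong[of _ _ card]) auto
      finally have 1: "?P (A - {x}) = fact (card (?B - {x})) *
          (\<Prod>u\<in>D - {v}. fact (card {y \<in> A. fst (e y) = u}))" .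
      have 2: "?P A = fact (card ?B) * (\<Prod>u\<in>D - {v}. fact (card {y \<in> A. fst (e y) = u}))"
        by (subst prod.remove[OF assms(2) vD]) simp
      have "card ?B = Suc (card (?B - {x}))" 
        using card_Suc_Diff1[of ?B x] x fin by simp
      thus ?thesis unfolding 1 2 by (simp add: algebra_simps)
    qed
    \<comment> \<open>The identity is proved after multiplication by the out-degree of v, which is
      nonzero in this case; this avoids dividing natural numbers.\<close>
    have "card ?B * (\<Sum>x\<in>?B. ?P (A - {x})) = card ?B * ?P A"
    proof -
      have "card ?B * (\<Sum>x\<in>?B. ?P (A - {x})) = (\<Sum>x\<in>?B. ?P A)"
        unfolding sum_distrib_left by (intro sum.cong refl P)
      thus ?thesis by (simp only: sum_constant of_nat_id)
    qed
    moreover have "card ?B \<noteq> 0" using y fin by auto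
    ultimately have "(\<Sum>x\<in>?B. ?P (A - {x})) = ?P A" by (rule mult_left_cancel[THEN iffD1, rotated])
    thus ?thesis using le by linarith
  qed
qed

text \<open>A closed walk carries its starting vertex twice, as \<open>w 0\<close> and as \<open>w n\<close>.\<close>

definition closed_walks :: "nat \<Rightarrow> nat \<Rightarrow> (nat \<Rightarrow> nat) set" where
  "closed_walks d n = {w \<in> PiE {..n} (\<lambda>_. {..<d}). w 0 = w n}"

text \<open>Step i of the walk uses the matrix with index \<alpha> i, so index j reads its edge at
  step \<alpha>^-1 j. The labelling records the monomial in the matrix entries that the pair
  contributes to T.\<close>

definition edge_labelling :: "nat \<Rightarrow> (nat \<Rightarrow> nat) \<times> (nat \<Rightarrow> nat) \<Rightarrow> nat \<Rightarrow> nat \<times> nat" where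
  "edge_labelling n = (\<lambda>(\<alpha>, w). \<lambda>j\<in>{..<n}. let i = inv_into UNIV \<alpha> j in (w i, w (Suc i)))"

abbreviation arranged_walks :: "nat \<Rightarrow> nat \<Rightarrow> ((nat \<Rightarrow> nat) \<times> (nat \<Rightarrow> nat)) set" where
  "arranged_walks d n \<equiv> {\<alpha>. \<alpha> permutes {..<n}} \<times> closed_walks d n"

lemma finite_closed_walks [simp]: "finite (closed_walks d n)"
  unfolding closed_walks_def by (rule finite_subset[of _ "PiE {..n} (\<lambda>_. {..<d})"]) (auto intro: finite_PiE)

lemma finite_arranged_walks [simp]: "finite (arranged_walks d n)"
  by (simp add: finite_permutations)

lemma sum_closed_walks:
  fixes f :: "(nat \<Rightarrow> nat) \<Rightarrow> 'a::comm_monoid_add"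
  assumes "n \<noteq> 0" "\<And>w. w \<in> closed_walks d n \<Longrightarrow> f w = f (restrict w {..<n})"
  shows "(\<Sum>w\<in>closed_walks d n. f w) = (\<Sum>a\<in>PiE {..<n} (\<lambda>_. {..<d}). f a)"
proof (rule sum.reindex_bij_witness[where i = "\<lambda>a. a(n := a 0)" and j = "\<lambda>w. restrict w {..<n}"])
  fix w assume w: "w \<in> closed_walks d n"
  show "(restrict w {..<n})(n := restrict w {..<n} 0) = w"
    using w assms(1) by (auto simp: closed_walks_def PiE_iff extensional_def fun_eq_iff)
  show "restrict w {..<n} \<in> PiE {..<n} (\<lambda>_. {..<d})"
    using w by (auto simp: closed_walks_def PiE_iff)
  show "f (restrict w {..<n}) = f w" using assms(2)[OF w] by simp
next
  fix a assume a: "a \<in> PiE {..<n} (\<lambda>_. {..<d})"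
  show "restrict (a(n := a 0)) {..<n} = a"
    using a by (auto simp: PiE_iff extensional_def fun_eq_iff)
  show "a(n := a 0) \<in> closed_walks d n"
    using a assms(1) by (auto simp: closed_walks_def PiE_iff extensional_def)
qed

lemma edge_labelling_in:
  assumes "x \<in> arranged_walks d n"
  shows "edge_labelling n x \<in> PiE {..<n} (\<lambda>_. {..<d} \<times> {..<d})"
proof -
  obtain \<alpha> w where x: "x = (\<alpha>, w)" "\<alpha> permutes {..<n}" "w \<in> closed_walks d n" using assms by auto
  have "inv_into UNIV \<alpha> j < n" if "j < n" for j
    using permutes_in_image[OF permutes_inv[OF x(2)], of j] that by auto
  hence "inv_into UNIV \<alpha> j \<le> n" "Suc (inv_into UNIV \<alpha> j) \<le> n" if "j < n" for j
    using that by (auto simp: less_imp_le Suc_le_eq)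
  thus ?thesis using x(3)
    by (auto simp: x(1) edge_labelling_def closed_walks_def PiE_iff Let_def)
qed

lemma edge_labelling_permuted:
  assumes "\<alpha> permutes {..<n}" "i < n"
  shows "edge_labelling n (\<alpha>, w) (\<alpha> i) = (w i, w (Suc i))"
  using permutes_in_image[OF assms(1), of i] assms
  by (auto simp: edge_labelling_def permutes_inverses)

lemma is_walk_map_upt:
  assumes "\<And>i. m \<le> i \<Longrightarrow> i < n \<Longrightarrow> e (\<alpha> i) = (w i, w (Suc i))"
  shows "is_walk e (w m) (map \<alpha> [m..<n])"
  using assms
proof (induction "n - m" arbitrary: m)
  case (Suc k)
  hence "[m..<n] = m # [Suc m..<n]" by (intro upt_conv_Cons) linarith
  moreover have "is_walk e (w (Suc m)) (map \<alpha> [Suc m..<n])" using Suc.hyps(2) Suc.prems by (intro Suc.hyps(1)) auto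
  ultimately show ?case using Suc.hyps(2) Suc.prems[of m] by simp
qed simp

text \<open>Once \<open>e\<close> is fixed, a preimage is determined by its starting vertex and by
  the list \<alpha> 0, ..., \<alpha> (n - 1), an ordering of all indices that is a walk through the
  edges \<open>e\<close>. The starting vertex contributes d, the orderings are bounded by
  \<open>card_walks_le\<close>; that the walk closes up is dropped from the count.\<close>

lemma card_edge_labelling_fibre:
  assumes n: "n \<noteq> 0" and e: "e \<in> PiE {..<n} (\<lambda>_. {..<d} \<times> {..<d})"
  shows "card {x \<in> arranged_walks d n. edge_labelling n x = e} \<le>
    d * (\<Prod>u<d. fact (card {j. j < n \<and> fst (e j) = u}))"
proof -
  let ?X = "{x \<in> arranged_walks d n. edge_labelling n x = e}"
  let ?Y = "\<lambda>v. {xs \<in> permutations_of_set {..<n}. is_walk e v xs}"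
  let ?f = "\<lambda>(\<alpha>, w). (w (0::nat) :: nat, map \<alpha> [0..<n])"
  have fin: "finite (?Y v)" for v by (rule finite_subset[of _ "permutations_of_set {..<n}"]) auto
  have inj: "inj_on ?f ?X"
  proof (rule inj_onI, clarsimp)
    fix \<alpha> w \<alpha>' w'
    assume h: "\<alpha> permutes {..<n}" "w \<in> closed_walks d n" "\<alpha>' permutes {..<n}" "w' \<in> closed_walks d n"
      "edge_labelling n (\<alpha>', w') = edge_labelling n (\<alpha>, w)" "w 0 = w' 0" "\<forall>x\<in>{0..<n}. \<alpha> x = \<alpha>' x"
    have al: "\<alpha> = \<alpha>'"
    proof
      fix x show "\<alpha> x = \<alpha>' x" using h(1,3,7) by (cases "x < n") (auto simp: permutes_def)
    qed
    have "w i = w' i" if "i < n" for i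
      using edge_labelling_permuted[OF h(1) that, of w] edge_labelling_permuted[OF h(3) that, of w'] h(5) al
      by simp
    \<comment> \<open>The sources of the edges recover \<open>w\<close> only below \<open>n\<close>;
      the last value comes from closedness.\<close>
    moreover have "w n = w' n" using h(2,4,6) by (simp add: closed_walks_def)
    ultimately have "w i = w' i" for i
      using h(2,4) by (cases "i \<le> n") (auto simp: closed_walks_def PiE_iff extensional_def le_less)
    thus "\<alpha> = \<alpha>' \<and> w = w'" using al by auto
  qed
  have "?f ` ?X \<subseteq> (SIGMA v:{..<d}. ?Y v)"
  proof (clarsimp, intro conjI)
    fix \<alpha> w assume h: "\<alpha> permutes {..<n}" "w \<in> closed_walks d n" "e = edge_labelling n (\<alpha>, w)"
    show "w 0 < d" using h(2) by (auto simp: closed_walks_def PiE_iff)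
    show "map \<alpha> [0..<n] \<in> permutations_of_set {..<n}"
      using h(1) permutes_image[OF h(1)] permutes_inj_on[OF h(1)]
      by (auto simp: permutations_of_set_def distinct_map atLeast0LessThan)
    show "is_walk (edge_labelling n (\<alpha>, w)) (w 0) (map \<alpha> [0..<n])"
      using edge_labelling_permuted[OF h(1)] by (intro is_walk_map_upt)
  qed
  hence "card ?X \<le> card (SIGMA v:{..<d}. ?Y v)"
    using fin by (intro card_inj_on_le[OF inj]) auto
  also have "\<dots> = (\<Sum>v<d. card (?Y v))" using fin by simp
  also have "\<dots> \<le> (\<Sum>v<d. \<Prod>u<d. fact (card {j \<in> {..<n}. fst (e j) = u}))"
    using e by (intro sum_mono card_walks_le) (auto simp: PiE_iff mem_Times_iff)
  finally show ?thesis by simp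
qed

text \<open>Each first pair is joined with the fibre of its labelling. The bound for the fibre
  depends only on the visit counts of the walk, so the sum over \<alpha> gives n! and the sum over
  walks is the one evaluated in \<open>sum_prod_fact_fibres\<close>.\<close>

lemma card_edge_labelling_pairs:
  assumes n: "n \<noteq> 0"
  shows "card {(x, y). x \<in> arranged_walks d n \<and> y \<in> arranged_walks d n \<and> edge_labelling n x = edge_labelling n y}
    \<le> fact n * (d * pochhammer d n)"
proof -
  let ?X = "\<lambda>x. {y \<in> arranged_walks d n. edge_labelling n y = edge_labelling n x}"
  have eq: "{(x, y). x \<in> arranged_walks d n \<and> y \<in> arranged_walks d n \<and> edge_labelling n x = edge_labelling n y}
      = (SIGMA x:arranged_walks d n. ?X x)" by auto
  have fin: "finite (?X x)" for x by (rule finite_subset[OF _ finite_arranged_walks]) auto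
  have "card (SIGMA x:arranged_walks d n. ?X x) = (\<Sum>x\<in>arranged_walks d n. card (?X x))"
    using fin by (intro card_SigmaI finite_arranged_walks) auto
  also have "\<dots> \<le> (\<Sum>x\<in>arranged_walks d n. d * (\<Prod>u<d. fact (card {i. i < n \<and> snd x i = u})))"
  proof (rule sum_mono)
    fix x assume x: "x \<in> arranged_walks d n"
    obtain \<alpha> w where xw: "x = (\<alpha>, w)" "\<alpha> permutes {..<n}" using x by auto
    \<comment> \<open>\<alpha> carries the times at which \<open>w\<close> visits u to the indices
      whose edge leaves u.\<close>
    have "card {j. j < n \<and> fst (edge_labelling n x j) = u} = card {i. i < n \<and> w i = u}" for u
    proof (rule bij_betw_same_card[of \<alpha>, symmetric], rule bij_betwI[of _ _ _ "inv_into UNIV \<alpha>"])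
      show "\<alpha> \<in> {i. i < n \<and> w i = u} \<rightarrow> {j. j < n \<and> fst (edge_labelling n x j) = u}"
        using edge_labelling_permuted[OF xw(2)] permutes_in_image[OF xw(2)] by (auto simp: xw)
      show "inv_into UNIV \<alpha> \<in> {j. j < n \<and> fst (edge_labelling n x j) = u} \<rightarrow> {i. i < n \<and> w i = u}"
        using permutes_in_image[OF permutes_inv[OF xw(2)]] by (auto simp: xw edge_labelling_def Let_def)
    qed (auto simp: permutes_inverses[OF xw(2)])
    thus "card (?X x) \<le> d * (\<Prod>u<d. fact (card {i. i < n \<and> snd x i = u}))"
      using card_edge_labelling_fibre[OF n edge_labelling_in[OF x]] by (simp add: xw)
  qed
  also have "\<dots> = fact n * (\<Sum>w\<in>closed_walks d n. d * (\<Prod>u<d. fact (card {i. i < n \<and> w i = u})))"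
  proof -
    have c: "(\<Sum>x\<in>A \<times> B. f (snd x)) = card A * (\<Sum>w\<in>B. f w)"
      for A :: "(nat \<Rightarrow> nat) set" and B and f :: "(nat \<Rightarrow> nat) \<Rightarrow> nat"
      using sum.cartesian_product[of "\<lambda>_ w. f w" B A] by (simp add: case_prod_unfold)
    show ?thesis
      using c[of "\<lambda>w. d * (\<Prod>u<d. fact (card {i. i < n \<and> w i = u}))" "{\<alpha>. \<alpha> permutes {..<n}}" "closed_walks d n"]
      by (simp add: card_permutations)
  qed
  also have "(\<Sum>w\<in>closed_walks d n. d * (\<Prod>u<d. fact (card {i. i < n \<and> w i = u}))) =
      (\<Sum>a\<in>PiE {..<n} (\<lambda>_. {..<d}). d * (\<Prod>u<d. fact (card {i. i < n \<and> a i = u})))"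
    by (rule sum_closed_walks[OF n])
       (auto intro!: arg_cong[of _ _ "(*) d"] prod.cong arg_cong[of _ _ fact] arg_cong[of _ _ card])
  also have "\<dots> = d * pochhammer d n"
    by (simp add: sum_distrib_left[symmetric] sum_prod_fact_fibres)
  finally show ?thesis unfolding eq .
qed

text \<open>Fixing d and letting n grow turns the rising factorial into n! times a polynomial of
  degree d - 1 in n. The induction on d compares d (d + 1) ... (d + n - 1) with its successor and
  uses d + n \<le> d (n + 1).\<close>

lemma pochhammer_le_fact_power:
  assumes "d \<ge> 1"
  shows "pochhammer d n \<le> fact n * (n + 1) ^ (d - 1)"
  using assms
proof (induction d rule: nat_induct_at_least)
  case base
  then show ?case by (simp add: pochhammer_fact)
next
  case (Suc d)
  have "d * pochhammer (Suc d) n = (d + n) * pochhammer d n"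
    using pochhammer_rec[of d n] pochhammer_rec'[of d n] by simp
  also have "\<dots> \<le> (d * (n + 1)) * (fact n * (n + 1) ^ (d - 1))"
  proof (intro mult_mono Suc.IH)
    have "n \<le> d * n" using Suc.hyps by simp
    thus "d + n \<le> d * (n + 1)" by simp
  qed auto
  also have "\<dots> = d * (fact n * (n + 1) ^ (Suc (d - 1)))" by (simp only: power_Suc mult_ac)
  finally have "pochhammer (Suc d) n \<le> fact n * (n + 1) ^ (Suc (d - 1))" using Suc.hyps by simp
  thus ?case using Suc.hyps by simp
qed

section \<open>Nearly orthogonal unit vectors\<close>

definition cdot :: "nat \<Rightarrow> (nat \<Rightarrow> complex) \<Rightarrow> (nat \<Rightarrow> complex) \<Rightarrow> complex" where
  "cdot d v w = (\<Sum>a<d. cnj (v a) * w a)"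

text \<open>Each pair holds the real and imaginary numerators of one complex coordinate. Coordinate
  0 is left out because it is normalized to 1, as in an affine chart of projective space.\<close>

abbreviation grid :: "nat \<Rightarrow> nat \<Rightarrow> (nat \<Rightarrow> nat \<times> nat) set" where
  "grid d K \<equiv> PiE {1..<d} (\<lambda>_. {..<K} \<times> {..<K})"

lemma card_grid: "card (grid d K) = K ^ (2 * (d - 1))"
  by (simp add: card_PiE power_mult power2_eq_square)

lemma finite_grid [simp]: "finite (grid d K)"
  by (intro finite_PiE) auto

text \<open>Terms on either side of k form part of a geometric series.\<close>

lemma sum_power_nat_dist_le:
  fixes q :: real
  assumes "0 \<le> q" "q < 1"
  shows "(\<Sum>l<K. q ^ nat \<bar>int k - int l\<bar>) \<le> 2 / (1 - q)"
proof -
  have geo: "(\<Sum>i\<in>A. q ^ i) \<le> 1 / (1 - q)" if "finite A" for A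
  proof -
    have "(\<Sum>i\<in>A. q ^ i) \<le> (\<Sum>i. q ^ i)"
      using assms that by (intro sum_le_suminf summable_geometric) auto
    thus ?thesis using assms by (simp add: suminf_geometric)
  qed
  have "(\<Sum>l<K. q ^ nat \<bar>int k - int l\<bar>) =
      (\<Sum>l\<in>{..<K} \<inter> {..k}. q ^ (k - l)) + (\<Sum>l\<in>{..<K} - {..k}. q ^ (l - k))"
    by (subst sum.Int_Diff[of _ _ "{..k}"]) (auto intro!: arg_cong2[of _ _ _ _ "(+)"] sum.cong
        arg_cong[of _ _ "power q"])
  also have "(\<Sum>l\<in>{..<K} \<inter> {..k}. q ^ (k - l)) = (\<Sum>i\<in>(\<lambda>l. k - l) ` ({..<K} \<inter> {..k}). q ^ i)"
    by (subst sum.reindex) (auto simp: inj_on_def)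
  also have "(\<Sum>l\<in>{..<K} - {..k}. q ^ (l - k)) = (\<Sum>i\<in>(\<lambda>l. l - k) ` ({..<K} - {..k}). q ^ i)"
    by (subst sum.reindex) (auto simp: inj_on_def)
  finally show ?thesis using geo[of "(\<lambda>l. k - l) ` ({..<K} \<inter> {..k})"] geo[of "(\<lambda>l. l - k) ` ({..<K} - {..k})"]
    by simp
qed

text \<open>Expanding both sides leaves only the Cauchy-Schwarz inequality for x and y. It measures
  how the overlap of the vectors (1, x) and (1, y) drops as x and y move apart.\<close>

lemma norm_one_plus_sum_le:
  fixes x y :: "'a \<Rightarrow> complex"
  shows "(cmod (1 + (\<Sum>a\<in>A. cnj (x a) * y a)))\<^sup>2 \<le>
     (1 + (\<Sum>a\<in>A. (cmod (x a))\<^sup>2)) * (1 + (\<Sum>a\<in>A. (cmod (y a))\<^sup>2)) - (\<Sum>a\<in>A. (cmod (x a - y a))\<^sup>2)"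
proof -
  define p where "p = (\<Sum>a\<in>A. cnj (x a) * y a)"
  define X where "X = (\<Sum>a\<in>A. (cmod (x a))\<^sup>2)"
  define Y where "Y = (\<Sum>a\<in>A. (cmod (y a))\<^sup>2)"
  have "cmod p \<le> (\<Sum>a\<in>A. \<bar>cmod (x a)\<bar> * \<bar>cmod (y a)\<bar>)"
    unfolding p_def by (rule order.trans[OF norm_sum]) (simp add: norm_mult)
  also have "\<dots> \<le> L2_set (\<lambda>a. cmod (x a)) A * L2_set (\<lambda>a. cmod (y a)) A" by (rule L2_set_mult_ineq)
  finally have "(cmod p)\<^sup>2 \<le> (L2_set (\<lambda>a. cmod (x a)) A * L2_set (\<lambda>a. cmod (y a)) A)\<^sup>2"
    by (intro power_mono) auto
  hence le: "(cmod p)\<^sup>2 \<le> X * Y"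
    by (simp add: power_mult_distrib L2_set_def X_def Y_def sum_nonneg)
  have "(cmod (u - v))\<^sup>2 = (cmod u)\<^sup>2 + (cmod v)\<^sup>2 - 2 * Re (cnj u * v)" for u v
    unfolding cmod_power2 by (simp add: power2_eq_square algebra_simps)
  hence D: "(\<Sum>a\<in>A. (cmod (x a - y a))\<^sup>2) = X + Y - 2 * Re p"
    by (simp add: X_def Y_def p_def sum.distrib sum_subtractf sum_distrib_left)
  have "(cmod (1 + p))\<^sup>2 = 1 + 2 * Re p + (cmod p)\<^sup>2"
    unfolding cmod_power2 by (simp add: power2_eq_square algebra_simps)
  thus ?thesis using le unfolding D p_def[symmetric] X_def[symmetric] Y_def[symmetric]
    by (simp add: algebra_simps)
qed

text \<open>The vectors are the normalized points (1, z) with z on a grid of spacing 1/K. A squared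
  overlap is at most 1 - \<delta>/(4 d^2), hence at most exp (-\<delta>/(4 d^2)), where \<delta> is
  the squared distance before normalization. The power 2 n of the squared overlap, with n \<ge> K^2,
  rescales the spacing to 1, so the sum splits into one geometric sum for each real coordinate,
  bounded independently of K and n.\<close>

lemma nearly_orthogonal_grid:
  assumes d: "d \<ge> 1"
  obtains C :: real where "C > 0"
    "\<And>K n. 1 \<le> K \<Longrightarrow> K\<^sup>2 \<le> n \<Longrightarrow> \<exists>v. (\<forall>k\<in>grid d K. cdot d (v k) (v k) = 1) \<and>
        (\<forall>k\<in>grid d K. (\<Sum>l\<in>grid d K. cmod (cdot d (v k) (v l)) ^ (4 * n)) \<le> C)"
proof
  \<comment> \<open>The decay per unit step: the exponent 2 n meets the factor 1/(4 d^2), since both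
    squared norms are at most 2 d.\<close>
  define q :: real where "q = exp (- 1 / (2 * real d ^ 2))"
  \<comment> \<open>Two geometric sums, for the real and the imaginary part, in each of d - 1
    coordinates.\<close>
  define C where "C = ((2 / (1 - q)) ^ 2) ^ (d - 1)"
  have q: "0 < q" "q < 1" using d by (auto simp: q_def)
  show "C > 0" using q by (auto simp: C_def)
  fix K n :: nat assume K: "1 \<le> K" "K\<^sup>2 \<le> n"
  define z where "z k a = (if a = 0 then 1 else Complex (real (fst (k a)) / K) (real (snd (k a)) / K))"
    for k :: "nat \<Rightarrow> nat \<times> nat" and a :: nat
  define N where "N k = 1 + (\<Sum>a=1..<d. (cmod (z k a))\<^sup>2)" for k
  define v where "v k a = z k a / of_real (sqrt (N k))" for k a
  define \<delta> where "\<delta> k l = (\<Sum>a=1..<d. (cmod (z k a - z l a))\<^sup>2)" for k l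
  have N1: "N k \<ge> 1" for k by (simp add: N_def sum_nonneg)
  have split: "(\<Sum>a<d. f a) = f 0 + (\<Sum>a=1..<d. f a)" for f :: "nat \<Rightarrow> complex"
    using d by (simp add: lessThan_atLeast0 sum.atLeast_Suc_lessThan)
  have dotz: "cdot d (z k) (z l) = 1 + (\<Sum>a=1..<d. cnj (z k a) * z l a)" for k l
    unfolding cdot_def split by (simp add: z_def)
  have dotv: "cdot d (v k) (v l) = cdot d (z k) (z l) / of_real (sqrt (N k) * sqrt (N l))" for k l
    by (simp add: cdot_def v_def sum_divide_distrib)
  have "cdot d (z k) (z k) = of_real (N k)" for k
    unfolding dotz N_def by (simp add: complex_norm_square[symmetric] mult.commute)
  hence unit: "cdot d (v k) (v k) = 1" for k
    using N1[of k] by (simp add: dotv flip: of_real_mult)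
  have bound: "(\<Sum>l\<in>grid d K. cmod (cdot d (v k) (v l)) ^ (4 * n)) \<le> C" if k: "k \<in> grid d K" for k
  proof -
    let ?h = "\<lambda>a (i, j). q ^ nat \<bar>int (fst (k a)) - int i\<bar> * q ^ nat \<bar>int (snd (k a)) - int j\<bar>"
    have N2: "N l \<le> 2 * real d" if l: "l \<in> grid d K" for l
    proof -
      have "(cmod (z l a))\<^sup>2 \<le> 2" if a: "a \<in> {1..<d}" for a
      proof -
        have "fst (l a) < K" "snd (l a) < K" using l a by (auto simp: PiE_iff mem_Times_iff)
        hence "(real (fst (l a)) / K)\<^sup>2 \<le> 1" "(real (snd (l a)) / K)\<^sup>2 \<le> 1"
          using K by (auto intro!: power_le_one)
        thus ?thesis using a by (simp add: z_def cmod_power2)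
      qed
      hence "(\<Sum>a=1..<d. (cmod (z l a))\<^sup>2) \<le> (\<Sum>a=1..<d. 2)" by (rule sum_mono)
      thus ?thesis using d by (simp add: N_def of_nat_diff)
    qed
    have overlap: "cmod (cdot d (v k) (v l)) ^ (4 * n) \<le> (\<Prod>a=1..<d. ?h a (l a))" if l: "l \<in> grid d K" for l
    proof -
      have d0: "0 \<le> \<delta> k l" by (simp add: \<delta>_def sum_nonneg)
      have NN: "N k * N l \<le> 4 * real d ^ 2" "N k * N l > 0"
        using mult_mono[OF N2[OF k] N2[OF l]] N1[of k] N1[of l] d by (auto simp: power2_eq_square)
      have "(cmod (cdot d (z k) (z l)))\<^sup>2 \<le> N k * N l - \<delta> k l"
        unfolding dotz N_def \<delta>_def by (rule norm_one_plus_sum_le)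
      hence "(cmod (cdot d (v k) (v l)))\<^sup>2 \<le> (N k * N l - \<delta> k l) / (N k * N l)"
        using N1[of k] N1[of l]
        by (simp add: dotv norm_divide norm_mult power_divide power_mult_distrib divide_right_mono)
      also have "\<dots> = 1 - \<delta> k l / (N k * N l)" using NN by (auto simp: diff_divide_distrib)
      also have "\<dots> \<le> 1 - \<delta> k l / (4 * real d ^ 2)" using NN d0 d N1[of k] N1[of l]
        by (intro diff_left_mono divide_left_mono mult_pos_pos) (auto intro: less_le_trans[OF zero_less_one])
      also have "\<dots> \<le> exp (- (\<delta> k l / (4 * real d ^ 2)))"
        using exp_ge_add_one_self[of "- (\<delta> k l / (4 * real d ^ 2))"] by simp
      finally have "((cmod (cdot d (v k) (v l)))\<^sup>2) ^ (2 * n) \<le> exp (- (\<delta> k l / (4 * real d ^ 2))) ^ (2 * n)"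
        by (rule power_mono) simp
      also have "\<dots> = exp (- (real n * \<delta> k l / (2 * real d ^ 2)))"
        by (simp add: exp_of_nat_mult[symmetric])
      also have "\<dots> \<le> exp (- (real (K\<^sup>2) * \<delta> k l / (2 * real d ^ 2)))"
        using K d0 by (auto intro!: divide_right_mono mult_right_mono simp flip: of_nat_power)
      also have "real (K\<^sup>2) * \<delta> k l = (\<Sum>a=1..<d. (real (fst (k a)) - real (fst (l a)))\<^sup>2 +
          (real (snd (k a)) - real (snd (l a)))\<^sup>2)"
        unfolding \<delta>_def sum_distrib_left using K
        by (intro sum.cong refl) (auto simp: z_def cmod_power2 power_divide field_simps
            simp flip: diff_divide_distrib)
      also have "exp (- (\<dots> / (2 * real d ^ 2))) = (\<Prod>a=1..<d.
          exp (- ((real (fst (k a)) - real (fst (l a)))\<^sup>2 / (2 * real d ^ 2))) *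
          exp (- ((real (snd (k a)) - real (snd (l a)))\<^sup>2 / (2 * real d ^ 2))))"
        by (simp only: exp_add[symmetric] exp_sum[symmetric, OF finite_atLeastLessThan] sum_divide_distrib
            sum_negf[symmetric] minus_add_distrib add_divide_distrib)
      also have "\<dots> \<le> (\<Prod>a=1..<d. ?h a (l a))"
      proof (rule prod_mono, intro conjI)
        \<comment> \<open>A natural number is at most its square, which replaces Gaussian decay by
          geometric decay.\<close>
        have e: "exp (- ((real i - real j)\<^sup>2 / (2 * real d ^ 2))) \<le> q ^ nat \<bar>int i - int j\<bar>" for i j
        proof -
          have "real (nat \<bar>int i - int j\<bar>) \<le> real ((nat \<bar>int i - int j\<bar>)\<^sup>2)"
            unfolding of_nat_le_iff power2_eq_square by (rule le_square)
          also have "\<dots> = (real i - real j)\<^sup>2" by simp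
          finally have "real (nat \<bar>int i - int j\<bar>) / (2 * real d ^ 2) \<le> (real i - real j)\<^sup>2 / (2 * real d ^ 2)"
            by (rule divide_right_mono) simp
          moreover have "q ^ nat \<bar>int i - int j\<bar> = exp (- (real (nat \<bar>int i - int j\<bar>) / (2 * real d ^ 2)))"
            unfolding q_def exp_of_nat_mult[symmetric] by simp
          ultimately show ?thesis by simp
        qed
        fix a
        show "exp (- ((real (fst (k a)) - real (fst (l a)))\<^sup>2 / (2 * real d ^ 2))) *
          exp (- ((real (snd (k a)) - real (snd (l a)))\<^sup>2 / (2 * real d ^ 2))) \<le> ?h a (l a)"
          unfolding case_prod_unfold using q by (intro mult_mono e) auto
      qed simp
      finally show ?thesis by (simp add: power_mult[symmetric])
    qed
    have "(\<Sum>l\<in>grid d K. cmod (cdot d (v k) (v l)) ^ (4 * n)) \<le> (\<Sum>l\<in>grid d K. \<Prod>a=1..<d. ?h a (l a))"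
      by (rule sum_mono) (rule overlap)
    also have "\<dots> = (\<Prod>a=1..<d. \<Sum>p\<in>{..<K} \<times> {..<K}. ?h a p)"
      by (rule prod_sum_PiE[symmetric]) auto
    also have "\<dots> \<le> (\<Prod>a=1..<d. (2 / (1 - q))\<^sup>2)"
    proof (rule prod_mono, intro conjI)
      fix a
      have "(\<Sum>p\<in>{..<K} \<times> {..<K}. ?h a p) = (\<Sum>i<K. q ^ nat \<bar>int (fst (k a)) - int i\<bar>) *
          (\<Sum>j<K. q ^ nat \<bar>int (snd (k a)) - int j\<bar>)"
        by (simp add: sum_product sum.cartesian_product)
      also have "\<dots> \<le> (2 / (1 - q)) * (2 / (1 - q))"
        using q by (intro mult_mono sum_power_nat_dist_le sum_nonneg) auto
      finally show "(\<Sum>p\<in>{..<K} \<times> {..<K}. ?h a p) \<le> (2 / (1 - q))\<^sup>2" by (simp add: power2_eq_square)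
    next
      fix a show "0 \<le> (\<Sum>p\<in>{..<K} \<times> {..<K}. ?h a p)" using q by (intro sum_nonneg) auto
    qed
    also have "\<dots> = C" by (simp add: C_def)
    finally show ?thesis .
  qed
  show "\<exists>v. (\<forall>k\<in>grid d K. cdot d (v k) (v k) = 1) \<and>
        (\<forall>k\<in>grid d K. (\<Sum>l\<in>grid d K. cmod (cdot d (v k) (v l)) ^ (4 * n)) \<le> C)"
    using unit bound by blast
qed

section \<open>The trace of the symmetrized determinant\<close>

text \<open>This is T as a multilinear polynomial in scalar entries, so that it can also be
  evaluated at conjugated entries and at rank-one projections.\<close>

definition walk_sum :: "nat \<Rightarrow> nat \<Rightarrow> (nat \<Rightarrow> nat \<times> nat \<Rightarrow> complex) \<Rightarrow> complex" where
  "walk_sum d n U = (\<Sum>x\<in>arranged_walks d n. 1 / fact n * (\<Prod>j<n. U j (edge_labelling n x j)))"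

section \<open>Entries of ordered products as sums over walks\<close>

lemma mult_mat_entry:
  fixes A B :: "'a::semiring_0 mat"
  assumes "A \<in> carrier_mat d d" "B \<in> carrier_mat d d" "x < d" "y < d"
  shows "(A * B) $$ (x, y) = (\<Sum>z<d. A $$ (x, z) * B $$ (z, y))"
  using assms by (auto simp: scalar_prod_def lessThan_atLeast0 intro!: sum.cong)

lemma ordered_prod_Suc:
  assumes "\<And>i. i < Suc n \<Longrightarrow> B i \<in> carrier_mat d d"
  shows "ordered_prod d (Suc n) B = ordered_prod d n B * B n"
proof -
  have carrier: "foldr (\<lambda>i C. B i * C) xs C \<in> carrier_mat d d"
    if "set xs \<subseteq> {..<n}" "C \<in> carrier_mat d d" for xs C
    using that assms by (induction xs) (auto intro!: mult_carrier_mat[of _ d d])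
  have "foldr (\<lambda>i C. B i * C) xs (C * D) = foldr (\<lambda>i C. B i * C) xs C * D"
    if "set xs \<subseteq> {..<n}" "C \<in> carrier_mat d d" "D \<in> carrier_mat d d" for xs C D
    using that
  proof (induction xs)
    case (Cons x xs)
    hence "B x \<in> carrier_mat d d" using assms by auto
    thus ?case using Cons carrier[of xs C] by (simp add: assoc_mult_mat[of _ d d _ d _ d])
  qed simp
  from this[of "[0..<n]" "1\<^sub>m d" "B n"] show ?thesis
    using assms[of n] by (simp add: ordered_prod_def atLeast_upt lessThan_atLeast0)
qed

lemma ordered_prod_carrier:
  assumes "\<And>i. i < n \<Longrightarrow> B i \<in> carrier_mat d d"
  shows "ordered_prod d n B \<in> carrier_mat d d"
  using assms
proof (induction n)
  case 0
  then show ?case by (simp add: ordered_prod_def)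
next
  case (Suc n)
  then show ?case by (subst ordered_prod_Suc) (auto intro!: mult_carrier_mat[of _ d d])
qed

text \<open>The conditions on both endpoints sit in the summand, so that the set of walks is a plain
  function space and the induction can split off the last vertex.\<close>

lemma ordered_prod_entry:
  assumes "\<And>i. i < n \<Longrightarrow> B i \<in> carrier_mat d d" "x < d" "y < d"
  shows "ordered_prod d n B $$ (x, y) =
    (\<Sum>w\<in>PiE {..<Suc n} (\<lambda>_. {..<d}). if w 0 = x \<and> w n = y then \<Prod>i<n. B i $$ (w i, w (Suc i)) else 0)"
  using assms
proof (induction n arbitrary: y)
  case 0
  have "(\<Sum>w\<in>PiE {..<Suc 0} (\<lambda>_. {..<d}). if w 0 = x \<and> w 0 = y then \<Prod>i<0. B i $$ (w i, w (Suc i)) else 0)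
      = (\<Sum>z<d. if z = x \<and> z = y then 1 else 0)"
    unfolding sum_PiE_lessThan_Suc lessThan_0 PiE_empty_domain by (simp only: sum.insert sum.empty finite.emptyI empty_iff prod.empty fun_upd_same) simp
  also have "\<dots> = (\<Sum>z<d. if z = x then (if x = y then 1 else 0) else 0)"
    by (intro sum.cong) auto
  finally show ?case using 0 by (simp add: ordered_prod_def)
next
  case (Suc n)
  let ?W = "PiE {..<Suc n} (\<lambda>_. {..<d})"
  let ?p = "\<lambda>w. \<Prod>i<n. B i $$ (w i, w (Suc i))"
  have Bn: "B n \<in> carrier_mat d d" and C: "ordered_prod d n B \<in> carrier_mat d d"
    using Suc.prems by (auto intro!: ordered_prod_carrier)
  have "ordered_prod d (Suc n) B $$ (x, y) = (\<Sum>z<d. ordered_prod d n B $$ (x, z) * B n $$ (z, y))"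
    using Suc.prems by (subst ordered_prod_Suc) (auto intro!: mult_mat_entry[OF C Bn])
  also have "\<dots> = (\<Sum>z<d. (\<Sum>w\<in>?W. if w 0 = x \<and> w n = z then ?p w else 0) * B n $$ (z, y))"
    using Suc by (intro sum.cong refl) auto
  also have "\<dots> = (\<Sum>z<d. \<Sum>w\<in>?W. if z = w n then (if w 0 = x then ?p w * B n $$ (z, y) else 0) else 0)"
    unfolding sum_distrib_right by (intro sum.cong refl) auto
  also have "\<dots> = (\<Sum>w\<in>?W. \<Sum>z<d. if z = w n then (if w 0 = x then ?p w * B n $$ (z, y) else 0) else 0)"
    by (rule sum.swap)
  also have "\<dots> = (\<Sum>w\<in>?W. if w 0 = x then ?p w * B n $$ (w n, y) else 0)"
    by (intro sum.cong refl) (auto simp: PiE_iff)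
  also have "\<dots> = (\<Sum>w\<in>?W. \<Sum>z<d. if z = y then (if w 0 = x then ?p w * B n $$ (w n, y) else 0) else 0)"
    using Suc.prems by simp
  also have "\<dots> = (\<Sum>z<d. \<Sum>w\<in>?W. if z = y then (if w 0 = x then ?p w * B n $$ (w n, y) else 0) else 0)"
    by (rule sum.swap)
  also have "\<dots> = (\<Sum>z<d. \<Sum>w\<in>?W. let w' = w(Suc n := z) in if w' 0 = x \<and> w' (Suc n) = y
      then \<Prod>i<Suc n. B i $$ (w' i, w' (Suc i)) else 0)"
    by (intro sum.cong refl) (auto simp: Let_def)
  finally show ?case unfolding sum_PiE_lessThan_Suc[of _ "Suc n"] Let_def .
qed

lemma trace_ordered_prod:
  assumes "\<And>i. i < n \<Longrightarrow> B i \<in> carrier_mat d d"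
  shows "(\<Sum>a<d. ordered_prod d n B $$ (a, a)) = (\<Sum>w\<in>closed_walks d n. \<Prod>i<n. B i $$ (w i, w (Suc i)))"
proof -
  let ?W = "PiE {..<Suc n} (\<lambda>_. {..<d})"
  have "(\<Sum>a<d. ordered_prod d n B $$ (a, a)) = (\<Sum>a<d. \<Sum>w\<in>?W. if w 0 = a \<and> w n = a
      then \<Prod>i<n. B i $$ (w i, w (Suc i)) else 0)"
    using assms by (intro sum.cong refl ordered_prod_entry) auto
  also have "\<dots> = (\<Sum>w\<in>?W. \<Sum>a<d. if a = w 0 then (if w 0 = w n then \<Prod>i<n. B i $$ (w i, w (Suc i)) else 0) else 0)"
    by (rule trans[OF sum.swap]) (intro sum.cong refl, simp)
  also have "\<dots> = (\<Sum>w\<in>?W. if w 0 = w n then \<Prod>i<n. B i $$ (w i, w (Suc i)) else 0)"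
    by (intro sum.cong refl) (auto simp: PiE_iff)
  also have "\<dots> = (\<Sum>w | w \<in> ?W \<and> w 0 = w n. \<Prod>i<n. B i $$ (w i, w (Suc i)))"
    by (rule sum.inter_filter[symmetric]) (auto intro: finite_PiE)
  finally show ?thesis by (simp add: closed_walks_def lessThan_Suc_atMost)
qed

lemma ordered_prod_eq_0:
  assumes "\<And>i. i < n \<Longrightarrow> B i \<in> carrier_mat d d" "i < n" "B i = 0\<^sub>m d d" "x < d" "y < d"
  shows "ordered_prod d n B $$ (x, y) = 0"
proof -
  have "(\<Prod>i<n. B i $$ (w i, w (Suc i))) = 0" if "w \<in> PiE {..<Suc n} (\<lambda>_. {..<d})" for w
    using assms(2,3) that by (intro prod_zero) (auto intro!: bexI[of _ i] simp: PiE_iff)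
  thus ?thesis using assms by (subst ordered_prod_entry) (auto intro!: sum.neutral)
qed

text \<open>If \<alpha>' differs from \<alpha>, some factor of the product is an off-diagonal entry
  of M and hence the zero matrix. The remaining terms carry the sign of the identity, and reindexing
  along \<alpha> turns positions into matrix indices.\<close>

lemma trace_sdet_diagonal:
  assumes R: "\<And>i j. i < n \<Longrightarrow> j < n \<Longrightarrow> R (i, j) \<in> carrier_mat d d"
  shows "mat_trace (sdet d n (\<lambda>ij. 1\<^sub>m n $$ ij \<cdot>\<^sub>m R ij)) = walk_sum d n (\<lambda>j p. R (j, j) $$ p)"
proof -
  let ?S = "{\<alpha>. \<alpha> permutes {..<n}}"
  let ?M = "\<lambda>ij. 1\<^sub>m n $$ ij \<cdot>\<^sub>m R ij"
  have lt: "\<alpha> i < n" if "\<alpha> \<in> ?S" "i < n" for \<alpha> i using that permutes_in_image[of \<alpha> "{..<n}" i] by auto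
  have M: "?M (\<alpha> i, \<alpha>' i) \<in> carrier_mat d d" if "\<alpha> \<in> ?S" "\<alpha>' \<in> ?S" "i < n" for \<alpha> \<alpha>' i
    using R lt that by auto
  have op: "ordered_prod d n (\<lambda>i. ?M (\<alpha> i, \<alpha>' i)) $$ (a, a) =
      (if \<alpha>' = \<alpha> then ordered_prod d n (\<lambda>i. R (\<alpha> i, \<alpha> i)) $$ (a, a) else 0)"
    if al: "\<alpha> \<in> ?S" "\<alpha>' \<in> ?S" and a: "a < d" for \<alpha> \<alpha>' a
  proof (cases "\<alpha>' = \<alpha>")
    case True
    have "foldr (\<lambda>i C. ?M (\<alpha> i, \<alpha> i) * C) xs D = foldr (\<lambda>i C. R (\<alpha> i, \<alpha> i) * C) xs D"
      if "set xs \<subseteq> {..<n}" for xs D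
      using that lt[OF al(1)] by (induction xs) (auto simp: smult_one)
    thus ?thesis using True by (simp add: ordered_prod_def atLeast_upt lessThan_atLeast0)
  next
    case False
    then obtain i where i: "\<alpha>' i \<noteq> \<alpha> i" by auto
    hence "i < n" using al by (auto simp: permutes_def) (metis not_less)
    hence "?M (\<alpha> i, \<alpha>' i) = 0\<^sub>m d d" using i lt al R[of "\<alpha> i" "\<alpha>' i"] by (auto intro!: eq_matI)
    hence "ordered_prod d n (\<lambda>i. ?M (\<alpha> i, \<alpha>' i)) $$ (a, a) = 0"
      using \<open>i < n\<close> M[OF al] a by (intro ordered_prod_eq_0) auto
    thus ?thesis using False by simp
  qed
  have sgn: "sign (\<alpha> \<circ> inv_into UNIV \<alpha>) = 1" if "\<alpha> \<in> ?S" for \<alpha>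
  proof -
    have "\<alpha> \<circ> inv_into UNIV \<alpha> = id" using that by (auto simp: fun_eq_iff permutes_inverses)
    thus ?thesis by simp
  qed
  have "mat_trace (sdet d n ?M) = (\<Sum>a<d. 1 / fact n * (\<Sum>\<alpha>\<in>?S. \<Sum>\<alpha>'\<in>?S.
      of_int (sign (\<alpha>' \<circ> inv_into UNIV \<alpha>)) * ordered_prod d n (\<lambda>i. ?M (\<alpha> i, \<alpha>' i)) $$ (a, a)))"
    by (simp add: mat_trace_def sdet_def)
  also have "\<dots> = (\<Sum>a<d. 1 / fact n * (\<Sum>\<alpha>\<in>?S. \<Sum>\<alpha>'\<in>?S.
      (if \<alpha>' = \<alpha> then ordered_prod d n (\<lambda>i. R (\<alpha> i, \<alpha> i)) $$ (a, a) else 0)))"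
    using sgn by (intro sum.cong refl arg_cong[of _ _ "(*) (1 / fact n)"]) (simp_all add: op)
  also have "\<dots> = (\<Sum>a<d. 1 / fact n * (\<Sum>\<alpha>\<in>?S. ordered_prod d n (\<lambda>i. R (\<alpha> i, \<alpha> i)) $$ (a, a)))"
    by (intro sum.cong refl arg_cong[of _ _ "(*) (1 / fact n)"]) (simp add: finite_permutations)
  also have "\<dots> = (\<Sum>\<alpha>\<in>?S. 1 / fact n * (\<Sum>a<d. ordered_prod d n (\<lambda>i. R (\<alpha> i, \<alpha> i)) $$ (a, a)))"
    unfolding sum_distrib_left by (rule sum.swap)
  also have "\<dots> = (\<Sum>\<alpha>\<in>?S. 1 / fact n * (\<Sum>w\<in>closed_walks d n. \<Prod>i<n. R (\<alpha> i, \<alpha> i) $$ (w i, w (Suc i))))"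
    using R lt by (intro sum.cong refl arg_cong[of _ _ "(*) (1 / fact n)"] trace_ordered_prod) auto
  also have "\<dots> = (\<Sum>\<alpha>\<in>?S. \<Sum>w\<in>closed_walks d n. 1 / fact n *
      (\<Prod>j<n. R (j, j) $$ edge_labelling n (\<alpha>, w) j))"
    unfolding sum_distrib_left
  proof (intro sum.cong refl arg_cong[of _ _ "(*) (1 / fact n)"])
    fix \<alpha> w assume al: "\<alpha> \<in> ?S"
    show "(\<Prod>i<n. R (\<alpha> i, \<alpha> i) $$ (w i, w (Suc i))) = (\<Prod>j<n. R (j, j) $$ edge_labelling n (\<alpha>, w) j)"
      using al edge_labelling_permuted[of \<alpha> n _ w]
      by (subst prod.reindex_bij_betw[OF permutes_imp_bij[of \<alpha>], symmetric]) (auto intro!: prod.cong)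
  qed
  also have "\<dots> = walk_sum d n (\<lambda>j p. R (j, j) $$ p)"
    unfolding walk_sum_def by (simp add: sum.cartesian_product case_prod_unfold)
  finally show ?thesis .
qed

section \<open>Evaluation at rank-one projections\<close>

definition rank_one :: "(nat \<Rightarrow> complex) \<Rightarrow> nat \<times> nat \<Rightarrow> complex" where
  "rank_one v p = v (fst p) * cnj (v (snd p))"

lemma cdot_self: "cdot d v v = (\<Sum>a<d. v a * cnj (v a))"
  by (simp add: cdot_def mult.commute)

text \<open>Along a closed walk every vertex is once the tail and once the head of an edge, so the
  product collects the squared moduli of v at the vertices. The sum over walks is then the n-th
  power of <v, v>, and the n! arrangements cancel the prefactor.\<close>

lemma walk_sum_rank_one:
  assumes n: "n \<noteq> 0" and v: "cdot d v v = 1"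
  shows "walk_sum d n (\<lambda>_. rank_one v) = 1"
proof -
  have "(\<Prod>j<n. rank_one v (edge_labelling n (\<alpha>, w) j)) = (\<Prod>i<n. v (w i) * cnj (v (w i)))"
    if al: "\<alpha> permutes {..<n}" and w: "w \<in> closed_walks d n" for \<alpha> w
  proof -
    have "(\<Prod>j<n. rank_one v (edge_labelling n (\<alpha>, w) j)) =
        (\<Prod>i<n. rank_one v (edge_labelling n (\<alpha>, w) (\<alpha> i)))"
      by (rule prod.reindex_bij_betw[OF permutes_imp_bij[OF al], symmetric])
    also have "\<dots> = (\<Prod>i<n. v (w i) * cnj (v (w (Suc i))))"
      using edge_labelling_permuted[OF al] by (intro prod.cong) (auto simp: rank_one_def)
    also have "\<dots> = (\<Prod>i<n. v (w i)) * (\<Prod>i<n. cnj (v (w (Suc i))))" by (rule prod.distrib)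
    \<comment> \<open>Shifting by one step loses \<open>w 0\<close> and gains \<open>w n\<close>,
      which are equal.\<close>
    also have "(\<Prod>i<n. cnj (v (w (Suc i)))) = (\<Prod>i<n. cnj (v (w i)))"
    proof -
      obtain m where m: "n = Suc m" using n by (cases n) auto
      have "w n = w 0" using w by (simp add: closed_walks_def)
      thus ?thesis unfolding m
        by (subst prod.lessThan_Suc_shift, subst prod.lessThan_Suc) (simp add: mult.commute)
    qed
    finally show ?thesis by (simp add: prod.distrib)
  qed
  hence "walk_sum d n (\<lambda>_. rank_one v) =
      (\<Sum>(\<alpha>, w)\<in>arranged_walks d n. 1 / fact n * (\<Prod>i<n. v (w i) * cnj (v (w i))))"
    unfolding walk_sum_def case_prod_unfold by (intro sum.cong refl) auto
  also have "\<dots> = (\<Sum>w\<in>closed_walks d n. \<Prod>i<n. v (w i) * cnj (v (w i)))"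
    by (simp add: sum.cartesian_product[symmetric] card_permutations sum_divide_distrib[symmetric])
  also have "\<dots> = (\<Sum>a\<in>PiE {..<n} (\<lambda>_. {..<d}). \<Prod>i<n. v (a i) * cnj (v (a i)))"
    by (rule sum_closed_walks[OF n]) auto
  also have "\<dots> = (\<Prod>i<n. \<Sum>a<d. v a * cnj (v a))"
    by (rule prod_sum_PiE[symmetric]) auto
  finally show ?thesis using v by (simp add: cdot_self)
qed

section \<open>Moments of random matrices\<close>

text \<open>The quadratic form <v, u v> of a matrix u, written as the entrywise inner product of
  \<open>rank_one v\<close> with u.\<close>

definition quad_form :: "nat \<Rightarrow> (nat \<Rightarrow> complex) \<Rightarrow> (nat \<times> nat \<Rightarrow> complex) \<Rightarrow> complex" where
  "quad_form d v u = (\<Sum>p\<in>{..<d} \<times> {..<d}. cnj (rank_one v p) * u p)"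

lemma quad_form_rank_one: "quad_form d v (rank_one w) = of_real ((cmod (cdot d v w))\<^sup>2)"
proof -
  have "quad_form d v (rank_one w) = (\<Sum>a<d. \<Sum>b<d. (cnj (v a) * w a) * cnj (cnj (v b) * w b))"
    by (simp add: quad_form_def rank_one_def sum.cartesian_product case_prod_unfold mult_ac)
  also have "\<dots> = cdot d v w * cnj (cdot d v w)"
    unfolding cdot_def cnj_sum sum_product ..
  finally show ?thesis by (simp only: complex_norm_square)
qed

lemma quad_form_square:
  "(quad_form d v u)\<^sup>2 = (\<Sum>r\<in>{..<d} \<times> {..<d}.
    \<Sum>s\<in>{..<d} \<times> {..<d}. cnj (rank_one v r) * cnj (rank_one v s) * (u r * u s))"
  unfolding power2_eq_square quad_form_def sum_product by (simp add: mult_ac)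

lemma borel_measurable_cnj [measurable]:
  assumes "f \<in> borel_measurable M"
  shows "(\<lambda>x. cnj (f x)) \<in> borel_measurable M"
  using assms by (rule borel_measurable_continuous_on[rotated]) (intro continuous_intros)

text \<open>A crude form of the inequality of arithmetic and geometric means, applied twice. Through
  it, fourth absolute moments of single entries dominate every mixed moment of degree four.\<close>

lemma norm_prod4_le:
  fixes a b c e :: real
  assumes "0 \<le> a" "0 \<le> b" "0 \<le> c" "0 \<le> e"
  shows "a * b * c * e \<le> a ^ 4 + b ^ 4 + c ^ 4 + e ^ 4"
proof -
  have amgm: "x * y \<le> x\<^sup>2 + y\<^sup>2" if "0 \<le> x" "0 \<le> y" for x y :: real
    using sum_squares_bound[of x y] mult_nonneg_nonneg[OF that] by linarith
  have "(a * b) * (c * e) \<le> (a * b)\<^sup>2 + (c * e)\<^sup>2" using assms by (intro amgm) auto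
  also have "\<dots> = a\<^sup>2 * b\<^sup>2 + c\<^sup>2 * e\<^sup>2" by (simp add: power_mult_distrib)
  also have "\<dots> \<le> ((a\<^sup>2)\<^sup>2 + (b\<^sup>2)\<^sup>2) + ((c\<^sup>2)\<^sup>2 + (e\<^sup>2)\<^sup>2)" by (intro add_mono amgm) auto
  finally show ?thesis by (simp add: mult_ac)
qed

text \<open>The facts about the distribution on which both estimates rest: uncorrelated entries for
  the upper bound, and the pairing with the square of a quadratic form for the lower bound. Gaussian
  and Haar matrices differ here only in the value of \<kappa>.\<close>

locale matrix_ensemble = prob_space \<mu> for \<mu> :: "complex mat measure" +
  fixes d :: nat and \<kappa> :: real
  assumes dim_pos: "d \<ge> 1"
    and space_subset: "space \<mu> \<subseteq> carrier_mat d d"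
    and entry_measurable: "p \<in> {..<d} \<times> {..<d} \<Longrightarrow> (\<lambda>B. B $$ p) \<in> borel_measurable \<mu>"
    and entry_integrable: "p \<in> {..<d} \<times> {..<d} \<Longrightarrow> integrable \<mu> (\<lambda>B. cmod (B $$ p) ^ 4)"
    and second_moment: "p \<in> {..<d} \<times> {..<d} \<Longrightarrow> q \<in> {..<d} \<times> {..<d} \<Longrightarrow>
      (\<integral>B. B $$ p * cnj (B $$ q) \<partial>\<mu>) = (if p = q then 1 / of_nat d else 0)"
    and fourth_moment: "p \<in> {..<d} \<times> {..<d} \<Longrightarrow> q \<in> {..<d} \<times> {..<d} \<Longrightarrow>
      (\<integral>B. B $$ p * B $$ q * cnj ((quad_form d v (($$) B))\<^sup>2) \<partial>\<mu>) = of_real \<kappa> * rank_one v p * rank_one v q"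
    and kappa_pos: "\<kappa> > 0"
begin

abbreviation entries :: "(nat \<times> nat) set" where
  "entries \<equiv> {..<d} \<times> {..<d}"

lemma integrable_quartic:
  assumes "p \<in> entries" "q \<in> entries" "r \<in> entries" "s \<in> entries"
  shows "integrable \<mu> (\<lambda>B. B $$ p * B $$ q * (cnj (B $$ r) * cnj (B $$ s)))"
proof (rule Bochner_Integration.integrable_bound)
  show "integrable \<mu> (\<lambda>B. cmod (B $$ p) ^ 4 + cmod (B $$ q) ^ 4 + cmod (B $$ r) ^ 4 + cmod (B $$ s) ^ 4)"
    using assms by (intro Bochner_Integration.integrable_add entry_integrable)
  note assms[THEN entry_measurable, measurable]
  show "(\<lambda>B. B $$ p * B $$ q * (cnj (B $$ r) * cnj (B $$ s))) \<in> borel_measurable \<mu>"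
    by measurable
  show "AE B in \<mu>. cmod (B $$ p * B $$ q * (cnj (B $$ r) * cnj (B $$ s)))
      \<le> norm (cmod (B $$ p) ^ 4 + cmod (B $$ q) ^ 4 + cmod (B $$ r) ^ 4 + cmod (B $$ s) ^ 4)"
    using norm_prod4_le by (intro AE_I2) (simp add: norm_mult mult.assoc[symmetric])
qed

lemma integrable_second:
  assumes "p \<in> entries" "q \<in> entries"
  shows "integrable \<mu> (\<lambda>B. B $$ p * cnj (B $$ q))"
proof (rule Bochner_Integration.integrable_bound)
  \<comment> \<open>The two ones stand for the missing factors in
    \<open>norm_prod4_le\<close>.\<close>
  show "integrable \<mu> (\<lambda>B. cmod (B $$ p) ^ 4 + cmod (B $$ q) ^ 4 + 1 + 1)"
    using assms by (intro Bochner_Integration.integrable_add entry_integrable) auto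
  note assms[THEN entry_measurable, measurable]
  show "(\<lambda>B. B $$ p * cnj (B $$ q)) \<in> borel_measurable \<mu>"
    by measurable
  show "AE B in \<mu>. cmod (B $$ p * cnj (B $$ q)) \<le> norm (cmod (B $$ p) ^ 4 + cmod (B $$ q) ^ 4 + 1 + 1)"
    using norm_prod4_le[of _ _ 1 1] by (intro AE_I2) (simp add: norm_mult)
qed

lemma has_second_moment:
  assumes "p \<in> entries" "q \<in> entries"
  shows "has_bochner_integral \<mu> (\<lambda>B. B $$ p * cnj (B $$ q)) (if p = q then 1 / of_nat d else 0)"
  using integrable_second[OF assms] second_moment[OF assms] by (simp add: has_bochner_integral_iff)

lemma has_fourth_moment:
  assumes "p \<in> entries" "q \<in> entries"
  shows "has_bochner_integral \<mu> (\<lambda>B. B $$ p * B $$ q * cnj ((quad_form d v (($$) B))\<^sup>2))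
    (of_real \<kappa> * rank_one v p * rank_one v q)"
proof -
  have "(\<lambda>B. B $$ p * B $$ q * cnj ((quad_form d v (($$) B))\<^sup>2)) =
      (\<lambda>B. \<Sum>r\<in>entries. \<Sum>s\<in>entries. rank_one v r * rank_one v s *
        (B $$ p * B $$ q * (cnj (B $$ r) * cnj (B $$ s))))"
    unfolding quad_form_square cnj_sum sum_distrib_left
    by (intro ext sum.cong refl) (simp add: mult_ac)
  moreover have "integrable \<mu> \<dots>"
    using assms by (intro Bochner_Integration.integrable_sum integrable_mult_right integrable_quartic)
  ultimately have "integrable \<mu> (\<lambda>B. B $$ p * B $$ q * cnj ((quad_form d v (($$) B))\<^sup>2))"
    by (simp only:)
  thus ?thesis unfolding has_bochner_integral_iff using fourth_moment[OF assms] by (rule conjI)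
qed

text \<open>Expanding only the first square and integrating term by term replaces each entry by one
  of \<open>rank_one w\<close>. What remains is \<kappa> times the square of the form of v at
  \<open>rank_one w\<close>, which is the squared modulus of <v, w>.\<close>

lemma has_quad_form_moment:
  "has_bochner_integral \<mu> (\<lambda>B. (quad_form d v (($$) B))\<^sup>2 * cnj ((quad_form d w (($$) B))\<^sup>2))
    (of_real (\<kappa> * cmod (cdot d v w) ^ 4))"
proof -
  have "has_bochner_integral \<mu> (\<lambda>B. \<Sum>r\<in>entries. \<Sum>s\<in>entries. (cnj (rank_one v r) * cnj (rank_one v s)) *
        (B $$ r * B $$ s * cnj ((quad_form d w (($$) B))\<^sup>2)))
      (\<Sum>r\<in>entries. \<Sum>s\<in>entries. (cnj (rank_one v r) * cnj (rank_one v s)) *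
        (of_real \<kappa> * rank_one w r * rank_one w s))"
    by (intro has_bochner_integral_sum has_bochner_integral_mult_right has_fourth_moment)
  also have "(\<lambda>B. \<Sum>r\<in>entries. \<Sum>s\<in>entries. (cnj (rank_one v r) * cnj (rank_one v s)) *
        (B $$ r * B $$ s * cnj ((quad_form d w (($$) B))\<^sup>2))) =
      (\<lambda>B. (quad_form d v (($$) B))\<^sup>2 * cnj ((quad_form d w (($$) B))\<^sup>2))"
    unfolding quad_form_square[of _ v] sum_distrib_right
    by (intro ext sum.cong refl) (simp add: mult_ac)
  also have "(\<Sum>r\<in>entries. \<Sum>s\<in>entries. (cnj (rank_one v r) * cnj (rank_one v s)) *
        (of_real \<kappa> * rank_one w r * rank_one w s)) = of_real \<kappa> * (quad_form d v (rank_one w))\<^sup>2"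
    unfolding quad_form_square sum_distrib_left
    by (intro sum.cong refl) (simp add: mult_ac)
  also have "\<dots> = of_real (\<kappa> * cmod (cdot d v w) ^ 4)"
    by (simp add: quad_form_rank_one power_mult[symmetric])
  finally show ?thesis .
qed

end

locale iid_ensemble = matrix_ensemble \<mu> d \<kappa> for \<mu> :: "complex mat measure" and d :: nat and \<kappa> :: real +
  fixes P :: "'a measure" and n :: nat and \<rho> :: "nat \<times> nat \<Rightarrow> 'a \<Rightarrow> complex mat"
  assumes iid: "iid_matrices P \<mu> n \<rho>" and n_pos: "n \<noteq> 0"
begin

sublocale P: prob_space P
  using iid by (simp add: iid_matrices_def)

definition U :: "'a \<Rightarrow> nat \<Rightarrow> nat \<times> nat \<Rightarrow> complex" where
  "U \<omega> j p = \<rho> (j, j) \<omega> $$ p"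

lemma rho_measurable: "i < n \<Longrightarrow> j < n \<Longrightarrow> \<rho> (i, j) \<in> measurable P \<mu>"
  using iid by (auto simp: iid_matrices_def P.indep_vars_def)

text \<open>Only the diagonal matrices enter T, so independence is restricted to the index pairs (j,
  j); each factor has under \<open>P\<close> the integral it has under \<mu>.\<close>

lemma has_integral_prod:
  fixes f :: "nat \<Rightarrow> complex mat \<Rightarrow> complex"
  assumes f: "\<And>j. j < n \<Longrightarrow> has_bochner_integral \<mu> (f j) (c j)"
  shows "has_bochner_integral P (\<lambda>\<omega>. \<Prod>j<n. f j (\<rho> (j, j) \<omega>)) (\<Prod>j<n. c j)"
proof -
  let ?D = "(\<lambda>j. (j, j)) ` {..<n}"
  let ?X = "\<lambda>ij \<omega>. f (fst ij) (\<rho> ij \<omega>)"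
  have meas: "f j \<in> borel_measurable \<mu>" if "j < n" for j
    using f[OF that] by (auto simp: has_bochner_integral_iff)
  have distr: "distr P \<mu> (\<rho> ij) = \<mu>" if "ij \<in> ?D" for ij
    using iid that by (auto simp: iid_matrices_def)
  have "P.indep_vars (\<lambda>_. \<mu>) \<rho> ?D"
  proof (rule P.indep_vars_subset)
    show "P.indep_vars (\<lambda>_. \<mu>) \<rho> ({..<n} \<times> {..<n})" using iid by (simp only: iid_matrices_def)
  qed auto
  hence ind: "P.indep_vars (\<lambda>_. borel) ?X ?D"
    by (rule P.indep_vars_compose2) (auto intro: meas)
  have X: "integrable P (?X ij)" "integral\<^sup>L P (?X ij) = c (fst ij)" if ij: "ij \<in> ?D" for ij
  proof -
    obtain j where j: "ij = (j, j)" "j < n" using ij by auto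
    have m: "\<rho> (j, j) \<in> measurable P \<mu>" using rho_measurable j by auto
    have "integrable (distr P \<mu> (\<rho> (j, j))) (f j)" "integral\<^sup>L (distr P \<mu> (\<rho> (j, j))) (f j) = c j"
      using f[OF j(2)] distr[OF ij] j by (auto simp: has_bochner_integral_iff)
    thus "integrable P (?X ij)" "integral\<^sup>L P (?X ij) = c (fst ij)"
      using integrable_distr_eq[OF m meas[OF j(2)]] integral_distr[OF m meas[OF j(2)]] j by auto
  qed
  have "has_bochner_integral P (\<lambda>\<omega>. \<Prod>ij\<in>?D. ?X ij \<omega>) (\<Prod>ij\<in>?D. c (fst ij))"
    using P.indep_vars_integrable[OF _ ind X(1)] P.indep_vars_lebesgue_integral[OF _ ind X(1)] X(2)
    by (simp add: has_bochner_integral_iff)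
  thus ?thesis by (simp add: prod.reindex inj_on_def)
qed

lemma integrable_prod:
  fixes f :: "nat \<Rightarrow> complex mat \<Rightarrow> complex"
  assumes f: "\<And>j. j < n \<Longrightarrow> integrable \<mu> (f j)"
  shows "integrable P (\<lambda>\<omega>. \<Prod>j<n. f j (\<rho> (j, j) \<omega>))"
  using has_integral_prod[of f "\<lambda>j. integral\<^sup>L \<mu> (f j)"] has_bochner_integral_integrable[OF f]
  by (auto simp: has_bochner_integral_iff)

abbreviation "T \<omega> \<equiv> walk_sum d n (U \<omega>)"

lemma X_s_eq:
  assumes "\<omega> \<in> space P"
  shows "X_s d n (1\<^sub>m n) (\<lambda>ij. \<rho> ij \<omega>) = (cmod (T \<omega>))\<^sup>2"
proof -
  have "\<rho> (i, j) \<omega> \<in> carrier_mat d d" if "i < n" "j < n" for i j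
    using measurable_space[OF rho_measurable[OF that] assms] space_subset by auto
  thus ?thesis by (simp add: X_s_def trace_sdet_diagonal U_def[abs_def])
qed

lemma edge_in: "x \<in> arranged_walks d n \<Longrightarrow> j < n \<Longrightarrow> edge_labelling n x j \<in> entries"
  using edge_labelling_in by (auto simp: PiE_iff)

lemma walk_sum_mult:
  "walk_sum d n u * walk_sum d n u' = (\<Sum>x\<in>arranged_walks d n. \<Sum>y\<in>arranged_walks d n.
     (1 / (fact n)\<^sup>2) * (\<Prod>j<n. u j (edge_labelling n x j) * u' j (edge_labelling n y j)))"
  unfolding walk_sum_def sum_product by (simp add: prod.distrib power2_eq_square)

lemma cnj_walk_sum: "cnj (walk_sum d n u) = walk_sum d n (\<lambda>j p. cnj (u j p))"
  by (simp add: walk_sum_def)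

text \<open>Expanding T times its conjugate, a pair of terms with different labellings has an index
  whose factor is an uncorrelated pair of entries and vanishes. Every other pair contributes 1/d for
  each of the n indices.\<close>

lemma expectation_X_s:
  "(\<integral>\<omega>. X_s d n (1\<^sub>m n) (\<lambda>ij. \<rho> ij \<omega>) \<partial>P) = card {(x, y). x \<in> arranged_walks d n \<and> y \<in> arranged_walks d n \<and>
      edge_labelling n x = edge_labelling n y} / ((fact n)\<^sup>2 * real d ^ n)"
  (is "_ = real (card ?Z) / _")
proof -
  let ?e = "edge_labelling n"
  let ?A = "arranged_walks d n"
  have "has_bochner_integral P (\<lambda>\<omega>. T \<omega> * cnj (T \<omega>)) (\<Sum>x\<in>?A. \<Sum>y\<in>?A. (1 / (fact n)\<^sup>2) *
      (\<Prod>j<n. if ?e x j = ?e y j then 1 / of_nat d else 0))"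
    unfolding cnj_walk_sum walk_sum_mult U_def
    by (intro has_bochner_integral_sum has_bochner_integral_mult_right has_integral_prod has_second_moment edge_in)
  also have "(\<Sum>x\<in>?A. \<Sum>y\<in>?A. (1 / (fact n)\<^sup>2) * (\<Prod>j<n. if ?e x j = ?e y j then 1 / of_nat d else 0)) =
      (\<Sum>x\<in>?A. \<Sum>y\<in>?A. if ?e x = ?e y then complex_of_real (1 / ((fact n)\<^sup>2 * real d ^ n)) else 0)"
  proof (intro sum.cong refl)
    fix x y assume xy: "x \<in> ?A" "y \<in> ?A"
    show "(1 / (fact n)\<^sup>2) * (\<Prod>j<n. if ?e x j = ?e y j then 1 / of_nat d else 0) =
      (if ?e x = ?e y then complex_of_real (1 / ((fact n)\<^sup>2 * real d ^ n)) else 0)"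
    proof (cases "?e x = ?e y")
      case True
      then show ?thesis by (simp add: power_one_over divide_simps)
    next
      case False
      then obtain j where "?e x j \<noteq> ?e y j" by auto
      moreover from this have "j < n" by (auto simp: edge_labelling_def case_prod_unfold split: if_splits)
      ultimately have "(\<Prod>j<n. if ?e x j = ?e y j then 1 / complex_of_nat d else 0) = 0"
        by (intro prod_zero) (auto intro!: bexI[of _ j])
      then show ?thesis using False by simp
    qed
  qed
  also have "\<dots> = (\<Sum>z\<in>?A \<times> ?A. if z \<in> ?Z then complex_of_real (1 / ((fact n)\<^sup>2 * real d ^ n)) else 0)"
    unfolding sum.cartesian_product by (intro sum.cong) (auto split: if_splits)
  also have "\<dots> = (\<Sum>z\<in>(?A \<times> ?A) \<inter> ?Z. complex_of_real (1 / ((fact n)\<^sup>2 * real d ^ n)))"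
    by (rule sum.inter_restrict[symmetric]) (intro finite_cartesian_product finite_arranged_walks)
  also have "(?A \<times> ?A) \<inter> ?Z = ?Z" by auto
  finally have "has_bochner_integral P (\<lambda>\<omega>. complex_of_real ((cmod (T \<omega>))\<^sup>2))
      (of_real (real (card ?Z) / ((fact n)\<^sup>2 * real d ^ n)))"
    unfolding complex_norm_square by simp
  hence "has_bochner_integral P (\<lambda>\<omega>. (cmod (T \<omega>))\<^sup>2) (real (card ?Z) / ((fact n)\<^sup>2 * real d ^ n))"
    unfolding has_bochner_integral_iff complex_of_real_integrable_eq integral_complex_of_real of_real_eq_iff .
  moreover have "(\<integral>\<omega>. X_s d n (1\<^sub>m n) (\<lambda>ij. \<rho> ij \<omega>) \<partial>P) = (\<integral>\<omega>. (cmod (T \<omega>))\<^sup>2 \<partial>P)"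
    by (intro Bochner_Integration.integral_cong) (simp_all add: X_s_eq)
  ultimately show ?thesis by (simp add: has_bochner_integral_iff)
qed

text \<open>The constant walk at vertex 0, paired with itself, is counted. Positivity allows
  dividing by the first moment later.\<close>

lemma expectation_X_s_pos: "(\<integral>\<omega>. X_s d n (1\<^sub>m n) (\<lambda>ij. \<rho> ij \<omega>) \<partial>P) > 0"
proof -
  let ?Z = "{(x, y). x \<in> arranged_walks d n \<and> y \<in> arranged_walks d n \<and> edge_labelling n x = edge_labelling n y}"
  have "(id, \<lambda>i\<in>{..n}. 0) \<in> arranged_walks d n"
    using dim_pos by (auto simp: closed_walks_def permutes_id)
  hence "((id, \<lambda>i\<in>{..n}. 0), (id, \<lambda>i\<in>{..n}. 0)) \<in> ?Z" by simp
  moreover have "finite ?Z"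
    by (rule finite_subset[of _ "arranged_walks d n \<times> arranged_walks d n"])
       (auto intro!: finite_cartesian_product finite_arranged_walks)
  ultimately have "card ?Z > 0" by (subst card_gt_0_iff) blast
  thus ?thesis unfolding expectation_X_s using dim_pos by simp
qed

lemma expectation_X_s_le:
  "(\<integral>\<omega>. X_s d n (1\<^sub>m n) (\<lambda>ij. \<rho> ij \<omega>) \<partial>P) \<le> real d * (real n + 1) ^ (d - 1) / real d ^ n"
proof -
  have "card {(x, y). x \<in> arranged_walks d n \<and> y \<in> arranged_walks d n \<and> edge_labelling n x = edge_labelling n y}
      \<le> fact n * (d * (fact n * (n + 1) ^ (d - 1)))"
    using card_edge_labelling_pairs[OF n_pos, of d] pochhammer_le_fact_power[OF dim_pos, of n]
    by (meson le_trans mult_le_mono2)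
  hence "real (card {(x, y). x \<in> arranged_walks d n \<and> y \<in> arranged_walks d n \<and> edge_labelling n x = edge_labelling n y})
      \<le> real (fact n * (d * (fact n * (n + 1) ^ (d - 1))))" by (simp only: of_nat_le_iff)
  also have "\<dots> = (fact n)\<^sup>2 * (real d * (real n + 1) ^ (d - 1))"
    by (simp add: power2_eq_square add.commute)
  finally show ?thesis unfolding expectation_X_s using dim_pos
    by (simp add: divide_simps mult_ac)
qed

text \<open>Testing \<open>T\<^sup>2\<close> against \<open>G = \<Sum>\<^sub>v \<Prod>\<^sub>j (v\<^sup>* U\<^sub>j v)\<^sup>2\<close>: the pairing of \<open>T\<^sup>2\<close> with each summand is \<open>\<kappa>\<^sup>n\<close>,
  because \<open>T\<close> takes the value 1 when all its arguments are the projection onto \<open>v\<close>.\<close>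

lemma expectation_X_s_squared_ge:
  assumes fin: "finite F" and C: "C > 0"
    and unit: "\<And>k. k \<in> F \<Longrightarrow> cdot d (v k) (v k) = 1"
    and overlap: "\<And>k. k \<in> F \<Longrightarrow> (\<Sum>l\<in>F. cmod (cdot d (v k) (v l)) ^ (4 * n)) \<le> C"
  shows "(\<integral>\<omega>. (X_s d n (1\<^sub>m n) (\<lambda>ij. \<rho> ij \<omega>))\<^sup>2 \<partial>P) \<ge> \<kappa> ^ n * card F / C"
proof -
  let ?A = "arranged_walks d n"
  let ?e = "edge_labelling n"
  define G where "G \<omega> = (\<Sum>k\<in>F. \<Prod>j<n. (quad_form d (v k) (U \<omega> j))\<^sup>2)" for \<omega>
  define s where "s = (\<Sum>k\<in>F. \<Sum>l\<in>F. (\<kappa> * cmod (cdot d (v k) (v l)) ^ 4) ^ n)"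
  have U: "U \<omega> j = ($$) (\<rho> (j, j) \<omega>)" for \<omega> j by (simp add: U_def[abs_def])
  have "has_bochner_integral P (\<lambda>\<omega>. \<Sum>k\<in>F. \<Sum>l\<in>F. \<Prod>j<n.
      (quad_form d (v k) (($$) (\<rho> (j, j) \<omega>)))\<^sup>2 * cnj ((quad_form d (v l) (($$) (\<rho> (j, j) \<omega>)))\<^sup>2))
    (\<Sum>k\<in>F. \<Sum>l\<in>F. \<Prod>j<n. of_real (\<kappa> * cmod (cdot d (v k) (v l)) ^ 4))"
    by (intro has_bochner_integral_sum has_integral_prod has_quad_form_moment)
  hence GG: "has_bochner_integral P (\<lambda>\<omega>. G \<omega> * cnj (G \<omega>)) (of_real s)"
    unfolding G_def s_def cnj_sum sum_product by (simp add: prod.distrib U)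

  have "has_bochner_integral P (\<lambda>\<omega>. \<Sum>k\<in>F. \<Sum>x\<in>?A. \<Sum>y\<in>?A. (1 / (fact n)\<^sup>2) * (\<Prod>j<n.
      \<rho> (j, j) \<omega> $$ ?e x j * \<rho> (j, j) \<omega> $$ ?e y j * cnj ((quad_form d (v k) (($$) (\<rho> (j, j) \<omega>)))\<^sup>2)))
    (\<Sum>k\<in>F. \<Sum>x\<in>?A. \<Sum>y\<in>?A. (1 / (fact n)\<^sup>2) * (\<Prod>j<n.
      of_real \<kappa> * rank_one (v k) (?e x j) * rank_one (v k) (?e y j)))"
    by (intro has_bochner_integral_sum has_bochner_integral_mult_right has_integral_prod has_fourth_moment edge_in)
  also have "(\<lambda>\<omega>. \<Sum>k\<in>F. \<Sum>x\<in>?A. \<Sum>y\<in>?A. (1 / (fact n)\<^sup>2) * (\<Prod>j<n.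
      \<rho> (j, j) \<omega> $$ ?e x j * \<rho> (j, j) \<omega> $$ ?e y j * cnj ((quad_form d (v k) (($$) (\<rho> (j, j) \<omega>)))\<^sup>2)))
      = (\<lambda>\<omega>. T \<omega> * T \<omega> * cnj (G \<omega>))"
    unfolding walk_sum_mult G_def cnj_sum sum_distrib_left sum_distrib_right
    by (simp add: prod.distrib U mult_ac)
  also have "(\<Sum>k\<in>F. \<Sum>x\<in>?A. \<Sum>y\<in>?A. (1 / (fact n)\<^sup>2) * (\<Prod>j<n.
      of_real \<kappa> * rank_one (v k) (?e x j) * rank_one (v k) (?e y j))) =
    (\<Sum>k\<in>F. of_real \<kappa> ^ n * (walk_sum d n (\<lambda>_. rank_one (v k)) * walk_sum d n (\<lambda>_. rank_one (v k))))"
    unfolding walk_sum_mult by (simp add: sum_distrib_left prod.distrib mult_ac)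
  also have "\<dots> = (\<Sum>k\<in>F. of_real \<kappa> ^ n)"
    by (intro sum.cong refl) (simp add: walk_sum_rank_one[OF n_pos unit])
  also have "\<dots> = of_real (\<kappa> ^ n * card F)" by simp
  finally have TG: "has_bochner_integral P (\<lambda>\<omega>. T \<omega> * T \<omega> * cnj (G \<omega>)) (of_real (\<kappa> ^ n * card F))" .

  \<comment> \<open>Integrability of the fourth power has to be shown separately, since the integral
    of a non-integrable function is 0 by convention and a lower bound would fail.\<close>
  have "integrable P (\<lambda>\<omega>. \<Sum>x\<in>?A. \<Sum>y\<in>?A. \<Sum>x'\<in>?A. \<Sum>y'\<in>?A. (1 / (fact n)\<^sup>2 * (1 / (fact n)\<^sup>2)) *
      (\<Prod>j<n. \<rho> (j, j) \<omega> $$ ?e x j * \<rho> (j, j) \<omega> $$ ?e y j *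
        (cnj (\<rho> (j, j) \<omega> $$ ?e x' j) * cnj (\<rho> (j, j) \<omega> $$ ?e y' j))))"
    by (intro Bochner_Integration.integrable_sum integrable_mult_right integrable_prod integrable_quartic edge_in)
  also have "(\<lambda>\<omega>. \<Sum>x\<in>?A. \<Sum>y\<in>?A. \<Sum>x'\<in>?A. \<Sum>y'\<in>?A. (1 / (fact n)\<^sup>2 * (1 / (fact n)\<^sup>2)) *
      (\<Prod>j<n. \<rho> (j, j) \<omega> $$ ?e x j * \<rho> (j, j) \<omega> $$ ?e y j *
        (cnj (\<rho> (j, j) \<omega> $$ ?e x' j) * cnj (\<rho> (j, j) \<omega> $$ ?e y' j)))) =
      (\<lambda>\<omega>. (T \<omega> * T \<omega>) * (cnj (T \<omega>) * cnj (T \<omega>)))"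
    unfolding cnj_walk_sum walk_sum_mult unfolding sum_distrib_right unfolding sum_distrib_left
    by (simp add: prod.distrib U mult_ac)
  also have "\<dots> = (\<lambda>\<omega>. of_real ((cmod (T \<omega>)) ^ 4))"
  proof
    fix \<omega>
    have "(T \<omega> * T \<omega>) * (cnj (T \<omega>) * cnj (T \<omega>)) = (T \<omega> * cnj (T \<omega>))\<^sup>2" by (simp add: power2_eq_square)
    also have "\<dots> = of_real ((cmod (T \<omega>)) ^ 4)"
      unfolding complex_norm_square[symmetric] by (simp add: power_mult[symmetric])
    finally show "(T \<omega> * T \<omega>) * (cnj (T \<omega>) * cnj (T \<omega>)) = of_real ((cmod (T \<omega>)) ^ 4)" .
  qed
  finally have T4: "integrable P (\<lambda>\<omega>. (cmod (T \<omega>)) ^ 4)"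
    by (simp only: complex_of_real_integrable_eq)

  \<comment> \<open>Cauchy-Schwarz is used in the form that the squared modulus of T^2 - lam G is
    nonnegative. With E|G|^2 bounded by C times the pairing of T^2 with G, the resulting lower bound
    is largest at lam = 1/C.\<close>
  define lam where "lam = 1 / C"
  have "has_bochner_integral P (\<lambda>\<omega>. Re (of_real (2 * lam) * (T \<omega> * T \<omega> * cnj (G \<omega>)) - of_real (lam\<^sup>2) * (G \<omega> * cnj (G \<omega>))))
      (Re (of_real (2 * lam) * of_real (\<kappa> ^ n * card F) - of_real (lam\<^sup>2) * of_real s))"
    by (intro has_bochner_integral_Re has_bochner_integral_diff has_bochner_integral_mult_right TG GG)
  hence low: "has_bochner_integral P (\<lambda>\<omega>. Re (of_real (2 * lam) * (T \<omega> * T \<omega> * cnj (G \<omega>)) - of_real (lam\<^sup>2) * (G \<omega> * cnj (G \<omega>))))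
      (2 * lam * (\<kappa> ^ n * card F) - lam\<^sup>2 * s)" by simp
  have pointwise: "Re (of_real (2 * lam) * (t * t * cnj g) - of_real (lam\<^sup>2) * (g * cnj g)) \<le> cmod t ^ 4" for t g
  proof -
    have "0 \<le> (cmod (t * t - of_real lam * g))\<^sup>2" by simp
    also have "\<dots> = (cmod (t * t))\<^sup>2 - Re (of_real (2 * lam) * (t * t * cnj g) - of_real (lam\<^sup>2) * (g * cnj g))"
      unfolding cmod_power2 by (simp add: power2_eq_square algebra_simps)
    also have "(cmod (t * t))\<^sup>2 = cmod t ^ 4" by (simp add: norm_mult power_mult_distrib flip: power_add)
    finally show ?thesis by simp
  qed
  have "s \<le> \<kappa> ^ n * card F * C"
  proof -
    have "s = \<kappa> ^ n * (\<Sum>k\<in>F. \<Sum>l\<in>F. cmod (cdot d (v k) (v l)) ^ (4 * n))"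
      by (simp add: s_def power_mult_distrib power_mult sum_distrib_left)
    also have "\<dots> \<le> \<kappa> ^ n * (\<Sum>k\<in>F. C)"
      using kappa_pos by (intro mult_left_mono sum_mono overlap) auto
    finally show ?thesis by simp
  qed
  hence "lam\<^sup>2 * s \<le> lam\<^sup>2 * (\<kappa> ^ n * card F * C)" by (intro mult_left_mono) auto
  also have "\<dots> = lam * (\<kappa> ^ n * card F)" using C by (simp add: lam_def power2_eq_square)
  finally have "\<kappa> ^ n * card F / C \<le> 2 * lam * (\<kappa> ^ n * card F) - lam\<^sup>2 * s" by (simp add: lam_def)
  also have "\<dots> \<le> (\<integral>\<omega>. cmod (T \<omega>) ^ 4 \<partial>P)"
    unfolding low[THEN has_bochner_integral_integral_eq, symmetric]
    using low T4 pointwise by (intro integral_mono) (auto simp: has_bochner_integral_iff simp del: Re_complex_of_real)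
  also have "\<dots> = (\<integral>\<omega>. (X_s d n (1\<^sub>m n) (\<lambda>ij. \<rho> ij \<omega>))\<^sup>2 \<partial>P)"
    by (intro Bochner_Integration.integral_cong) (simp_all add: X_s_eq power_mult[symmetric])
  finally show ?thesis .
qed

end

section \<open>The Borel structure of matrices\<close>

lemma space_borel_mat [simp]: "space (borel_mat d) = carrier_mat d d"
  by (simp add: borel_mat_def)

lemma entry_measurable_borel_mat:
  assumes "p \<in> {..<d} \<times> {..<d}"
  shows "(\<lambda>B. B $$ p) \<in> borel_measurable (borel_mat d)"
proof -
  let ?f = "\<lambda>B. \<lambda>ij\<in>{..<d} \<times> {..<d}. B $$ ij"
  have "?f \<in> measurable (borel_mat d) (\<Pi>\<^sub>M ij\<in>{..<d} \<times> {..<d}. (borel :: complex measure))"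
    unfolding borel_mat_def by (rule measurable_vimage_algebra1) (auto simp: space_PiM)
  from measurable_compose[OF this measurable_component_singleton[OF assms]]
  show ?thesis using assms by simp
qed

lemma measurable_borel_matI:
  assumes "f \<in> space M \<rightarrow> carrier_mat d d"
    and "\<And>p. p \<in> {..<d} \<times> {..<d} \<Longrightarrow> (\<lambda>x. f x $$ p) \<in> borel_measurable M"
  shows "f \<in> measurable M (borel_mat d)"
  unfolding borel_mat_def
  by (rule measurable_vimage_algebra2[OF assms(1)]) (rule measurable_restrict[OF assms(2)])

section \<open>Moments of Haar unitaries\<close>

lemma mat_adjoint_entry:
  assumes "A \<in> carrier_mat d d" "i < d" "j < d"
  shows "mat_adjoint A $$ (i, j) = cnj (A $$ (j, i))"
  using assms by (simp add: mat_adjoint_def mat_of_rows_def)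

lemma mat_adjoint_carrier:
  assumes "A \<in> carrier_mat d d"
  shows "mat_adjoint A \<in> carrier_mat d d"
  using assms by (auto simp: mat_adjoint_def)

lemma unitary_group_columns:
  assumes "V \<in> unitary_group d" "i < d" "j < d"
  shows "(\<Sum>z<d. cnj (V $$ (z, i)) * V $$ (z, j)) = (if i = j then 1 else 0)"
proof -
  have V: "V \<in> carrier_mat d d" "mat_adjoint V * V = 1\<^sub>m d" using assms by (auto simp: unitary_group_def)
  have "(mat_adjoint V * V) $$ (i, j) = (\<Sum>z<d. cnj (V $$ (z, i)) * V $$ (z, j))"
    using V(1) assms mat_adjoint_carrier[OF V(1)]
    by (subst mult_mat_entry) (auto intro!: sum.cong simp: mat_adjoint_entry)
  thus ?thesis using V(2) assms by simp
qed

text \<open>Orthonormal columns suffice, because a left inverse of a square matrix is also a right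
  inverse.\<close>

lemma unitary_groupI:
  assumes V: "V \<in> carrier_mat d d"
    and "\<And>i j. i < d \<Longrightarrow> j < d \<Longrightarrow> (\<Sum>z<d. cnj (V $$ (z, i)) * V $$ (z, j)) = (if i = j then 1 else 0)"
  shows "V \<in> unitary_group d"
proof -
  note A = mat_adjoint_carrier[OF V]
  have 1: "mat_adjoint V * V = 1\<^sub>m d"
  proof (rule eq_matI)
    fix i j assume "i < dim_row (1\<^sub>m d)" "j < dim_col (1\<^sub>m d)"
    hence ij: "i < d" "j < d" by auto
    have "(mat_adjoint V * V) $$ (i, j) = (\<Sum>z<d. cnj (V $$ (z, i)) * V $$ (z, j))"
      using V A ij by (subst mult_mat_entry) (auto intro!: sum.cong simp: mat_adjoint_entry)
    thus "(mat_adjoint V * V) $$ (i, j) = 1\<^sub>m d $$ (i, j)" using assms(2)[OF ij] ij by simp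
  qed (use V A in auto)
  have "V * mat_adjoint V = 1\<^sub>m d" by (rule mat_mult_left_right_inverse[OF A V 1])
  thus ?thesis using V 1 by (simp add: unitary_group_def)
qed

lemma mult_unitary:
  assumes "V \<in> unitary_group d" "B \<in> unitary_group d"
  shows "V * B \<in> unitary_group d"
proof (rule unitary_groupI)
  have VB: "V \<in> carrier_mat d d" "B \<in> carrier_mat d d" using assms by (auto simp: unitary_group_def)
  thus "V * B \<in> carrier_mat d d" by simp
  fix i j assume ij: "i < d" "j < d"
  have "(\<Sum>z<d. cnj ((V * B) $$ (z, i)) * (V * B) $$ (z, j)) =
      (\<Sum>z<d. \<Sum>x<d. \<Sum>y<d. cnj (B $$ (x, i)) * B $$ (y, j) * (cnj (V $$ (z, x)) * V $$ (z, y)))"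
    using VB ij by (intro sum.cong refl) (simp add: mult_mat_entry sum_product del: index_mult_mat, simp add: mult_ac)
  also have "\<dots> = (\<Sum>x<d. \<Sum>y<d. \<Sum>z<d. cnj (B $$ (x, i)) * B $$ (y, j) * (cnj (V $$ (z, x)) * V $$ (z, y)))"
    by (rule trans[OF sum.swap], rule sum.cong[OF refl], rule trans[OF sum.swap], rule sum.cong[OF refl refl])
  also have "\<dots> = (\<Sum>x<d. \<Sum>y<d. if y = x then cnj (B $$ (x, i)) * B $$ (y, j) else 0)"
    using unitary_group_columns[OF assms(1)]
    by (intro sum.cong refl) (auto simp: sum_distrib_left[symmetric])
  also have "\<dots> = (if i = j then 1 else 0)"
    using unitary_group_columns[OF assms(2) ij] by simp
  finally show "(\<Sum>z<d. cnj ((V * B) $$ (z, i)) * (V * B) $$ (z, j)) = (if i = j then 1 else 0)" .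
qed

lemma norm_unitary_entry_le_1:
  assumes "V \<in> unitary_group d" "i < d" "j < d"
  shows "cmod (V $$ (i, j)) \<le> 1"
proof -
  have "complex_of_real (\<Sum>z<d. (cmod (V $$ (z, j)))\<^sup>2) = 1"
    using unitary_group_columns[OF assms(1,3,3)]
    by (simp add: complex_norm_square mult.commute del: of_real_power)
  hence "(\<Sum>z<d. (cmod (V $$ (z, j)))\<^sup>2) = 1" by (simp only: of_real_eq_1_iff)
  moreover have "(cmod (V $$ (i, j)))\<^sup>2 \<le> (\<Sum>z<d. (cmod (V $$ (z, j)))\<^sup>2)"
    using assms by (intro member_le_sum) auto
  ultimately show ?thesis by (simp add: abs_square_le_1)
qed

text \<open>Multiplication from the left scales row t by the imaginary unit. This single phase is
  enough: with at most two plain and two conjugated factors, the net exponent at t lies between -2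
  and 2, where the power is 1 only for exponent 0.\<close>

definition phase_mat :: "nat \<Rightarrow> nat \<Rightarrow> complex mat" where
  "phase_mat d t = mat d d (\<lambda>(i, j). if i = j then (if i = t then \<i> else 1) else 0)"

text \<open>p and q stand for cosine and sine. The values (0, 1) exchange rows a and c up to sign,
  the values (3/5, 4/5) mix them with rational coefficients.\<close>

definition plane_rotation :: "nat \<Rightarrow> nat \<Rightarrow> nat \<Rightarrow> real \<Rightarrow> real \<Rightarrow> complex mat" where
  "plane_rotation d a c p q = mat d d (\<lambda>(i, j).
     if i = a then (if j = a then of_real p else if j = c then of_real q else 0)
     else if i = c then (if j = a then - of_real q else if j = c then of_real p else 0)
     else if i = j then 1 else 0)"

lemma phase_mat_unitary: "phase_mat d t \<in> unitary_group d"
proof (rule unitary_groupI)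
  fix i j assume ij: "i < d" "j < d"
  have "(\<Sum>z<d. cnj (phase_mat d t $$ (z, i)) * phase_mat d t $$ (z, j)) =
      (\<Sum>z<d. if z = i then (if i = j then 1 else 0) else 0)"
    using ij by (intro sum.cong) (auto simp: phase_mat_def)
  thus "(\<Sum>z<d. cnj (phase_mat d t $$ (z, i)) * phase_mat d t $$ (z, j)) = (if i = j then 1 else 0)"
    using ij by simp
qed (simp add: phase_mat_def)

lemma plane_rotation_unitary:
  assumes ac: "a < d" "c < d" "a \<noteq> c" and pq: "p\<^sup>2 + q\<^sup>2 = 1"
  shows "plane_rotation d a c p q \<in> unitary_group d"
proof (rule unitary_groupI)
  fix i j assume ij: "i < d" "j < d"
  let ?V = "plane_rotation d a c p q"
  let ?f = "\<lambda>z. cnj (?V $$ (z, i)) * ?V $$ (z, j)"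
  have pq': "complex_of_real p * of_real p + of_real q * of_real q = 1"
    using pq by (simp flip: of_real_mult of_real_add add: power2_eq_square)
  have "(\<Sum>z<d. ?f z) = ?f a + (?f c + (\<Sum>z\<in>{..<d} - {a} - {c}. ?f z))"
    using ac by (subst sum.remove[of _ a], simp, simp, subst sum.remove[of _ c]) auto
  also have "(\<Sum>z\<in>{..<d} - {a} - {c}. ?f z) =
      (\<Sum>z\<in>{..<d} - {a} - {c}. if z = i then (if i = j then 1 else 0) else 0)"
    using ij by (intro sum.cong) (auto simp: plane_rotation_def)
  also have "?f a + (?f c + \<dots>) = (if i = j then 1 else 0)"
    using ac ij pq' by (auto simp: plane_rotation_def algebra_simps)
  finally show "(\<Sum>z<d. ?f z) = (if i = j then 1 else 0)" .
qed (simp add: plane_rotation_def)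

section \<open>Left invariance of the Haar measure\<close>

locale haar_measure =
  fixes d :: nat and \<mu> :: "complex mat measure"
  assumes haar: "haar_unitary d \<mu>" and dim: "d \<ge> 1"
begin

sublocale prob_space \<mu> using haar by (simp add: haar_unitary_def)

lemma space_haar: "space \<mu> = unitary_group d"
  using haar by (simp add: haar_unitary_def)

lemma sets_haar: "sets \<mu> = sets (restrict_space (borel_mat d) (unitary_group d))"
  using haar by (simp add: haar_unitary_def)

lemma entry_measurable_haar [measurable]:
  assumes "a < d" "b < d"
  shows "(\<lambda>B. B $$ (a, b)) \<in> borel_measurable \<mu>"
  using measurable_restrict_space1[OF entry_measurable_borel_mat[of "(a, b)" d], of "unitary_group d"] assms
  by (simp add: measurable_cong_sets[OF sets_haar])

lemma mult_left_measurable: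
  assumes "V \<in> unitary_group d"
  shows "(\<lambda>B. V * B) \<in> measurable \<mu> \<mu>"
proof -
  have V: "V \<in> carrier_mat d d" using assms by (auto simp: unitary_group_def)
  have car: "B \<in> carrier_mat d d" if "B \<in> space \<mu>" for B
    using that by (auto simp: space_haar unitary_group_def)
  have "(\<lambda>B. V * B) \<in> measurable \<mu> (borel_mat d)"
  proof (rule measurable_borel_matI)
    show "(\<lambda>B. V * B) \<in> space \<mu> \<rightarrow> carrier_mat d d" using V car by auto
    fix p assume p: "p \<in> {..<d} \<times> {..<d}"
    have "(\<lambda>B. \<Sum>z<d. V $$ (fst p, z) * B $$ (z, snd p)) \<in> borel_measurable \<mu>"
      using p by (intro borel_measurable_sum borel_measurable_times borel_measurable_const entry_measurable_haar) auto
    also have "?this \<longleftrightarrow> (\<lambda>B. (V * B) $$ p) \<in> borel_measurable \<mu>"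
      using p V car by (intro measurable_cong) (auto simp: mult_mat_entry simp del: index_mult_mat)
    finally show "(\<lambda>B. (V * B) $$ p) \<in> borel_measurable \<mu>" .
  qed
  hence "(\<lambda>B. V * B) \<in> measurable \<mu> (restrict_space (borel_mat d) (unitary_group d))"
    using mult_unitary[OF assms] by (intro measurable_restrict_space2) (auto simp: space_haar)
  thus ?thesis by (simp add: measurable_cong_sets[OF refl sets_haar])
qed

lemma integral_mult_left:
  fixes f :: "complex mat \<Rightarrow> complex"
  assumes "V \<in> unitary_group d" "f \<in> borel_measurable \<mu>"
  shows "(\<integral>B. f (V * B) \<partial>\<mu>) = (\<integral>B. f B \<partial>\<mu>)"
proof -
  have "distr \<mu> \<mu> (\<lambda>B. V * B) = \<mu>" using haar assms by (auto simp: haar_unitary_def)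
  thus ?thesis using integral_distr[OF mult_left_measurable[OF assms(1)] assms(2)] by simp
qed

text \<open>Entry a of the vector B x. Left multiplication acts on the row index alone, so keeping
  the columns in a fixed vector x makes left invariance sufficient for all moments below.\<close>

definition row_comb :: "(nat \<Rightarrow> complex) \<Rightarrow> nat \<Rightarrow> complex mat \<Rightarrow> complex" where
  "row_comb x a B = (\<Sum>b<d. B $$ (a, b) * x b)"

lemma row_measurable [measurable]: "a < d \<Longrightarrow> row_comb x a \<in> borel_measurable \<mu>"
  unfolding row_comb_def[abs_def]
  by (intro borel_measurable_sum borel_measurable_times borel_measurable_const entry_measurable_haar) auto

lemma norm_row_le:
  assumes "B \<in> space \<mu>" "a < d"
  shows "cmod (row_comb x a B) \<le> (\<Sum>b<d. cmod (x b))"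
  unfolding row_comb_def using norm_unitary_entry_le_1[of B d a] assms
  by (intro order.trans[OF norm_sum] sum_mono) (auto simp: norm_mult space_haar intro!: mult_left_le_one_le)

lemma row_mult:
  assumes V: "V \<in> unitary_group d" and "B \<in> space \<mu>" "a < d"
    and S: "S \<subseteq> {..<d}" "\<And>z. z < d \<Longrightarrow> z \<notin> S \<Longrightarrow> V $$ (a, z) = 0"
  shows "row_comb x a (V * B) = (\<Sum>z\<in>S. V $$ (a, z) * row_comb x z B)"
proof -
  have VB: "V \<in> carrier_mat d d" "B \<in> carrier_mat d d"
    using assms by (auto simp: unitary_group_def space_haar)
  have "row_comb x a (V * B) = (\<Sum>b<d. \<Sum>z<d. V $$ (a, z) * (B $$ (z, b) * x b))"
    unfolding row_comb_def using VB assms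
    by (intro sum.cong refl) (simp add: mult_mat_entry sum_distrib_right sum_distrib_left mult_ac del: index_mult_mat)
  also have "\<dots> = (\<Sum>z<d. \<Sum>b<d. V $$ (a, z) * (B $$ (z, b) * x b))" by (rule sum.swap)
  also have "\<dots> = (\<Sum>z<d. V $$ (a, z) * row_comb x z B)" by (simp add: row_comb_def sum_distrib_left)
  also have "\<dots> = (\<Sum>z\<in>S. V $$ (a, z) * row_comb x z B)"
    using S by (intro sum.mono_neutral_right) auto
  finally show ?thesis .
qed

text \<open>A unitary B preserves inner products. Summing a moment over a matching pair of row
  indices therefore removes the randomness of that pair.\<close>

lemma sum_rows:
  assumes "B \<in> space \<mu>"
  shows "(\<Sum>a<d. row_comb x a B * cnj (row_comb y a B)) = cdot d y x"
proof -
  have "(\<Sum>a<d. row_comb x a B * cnj (row_comb y a B)) =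
      (\<Sum>a<d. \<Sum>b<d. \<Sum>e<d. (x b * cnj (y e)) * (cnj (B $$ (a, e)) * B $$ (a, b)))"
    by (intro sum.cong refl) (simp add: row_comb_def sum_product mult_ac)
  also have "\<dots> = (\<Sum>b<d. \<Sum>e<d. \<Sum>a<d. (x b * cnj (y e)) * (cnj (B $$ (a, e)) * B $$ (a, b)))"
    by (rule trans[OF sum.swap], rule sum.cong[OF refl], rule trans[OF sum.swap], rule sum.cong[OF refl refl])
  also have "\<dots> = (\<Sum>b<d. \<Sum>e<d. if e = b then x b * cnj (y e) else 0)"
    using assms unitary_group_columns[of B]
    by (intro sum.cong refl) (auto simp: sum_distrib_left[symmetric] space_haar)
  finally show ?thesis by (simp add: cdot_def mult.commute)
qed

lemma row_integrable2:
  assumes "a < d" "c < d"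
  shows "integrable \<mu> (\<lambda>B. row_comb x a B * cnj (row_comb y c B))"
proof (rule integrable_const_bound[of _ "(\<Sum>b<d. cmod (x b)) * (\<Sum>b<d. cmod (y b))"])
  show "AE B in \<mu>. cmod (row_comb x a B * cnj (row_comb y c B)) \<le> (\<Sum>b<d. cmod (x b)) * (\<Sum>b<d. cmod (y b))"
    using assms norm_row_le by (intro AE_I2) (auto simp: norm_mult intro!: mult_mono sum_nonneg)
qed (use assms in measurable)

lemma row_integrable4:
  assumes "a < d" "c < d" "e < d" "g < d"
  shows "integrable \<mu> (\<lambda>B. row_comb x a B * row_comb x' c B * (cnj (row_comb y e B) * cnj (row_comb y g B)))"
proof (rule integrable_const_bound[of _ "((\<Sum>b<d. cmod (x b)) * (\<Sum>b<d. cmod (x' b))) * ((\<Sum>b<d. cmod (y b)) * (\<Sum>b<d. cmod (y b)))"])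
  show "AE B in \<mu>. cmod (row_comb x a B * row_comb x' c B * (cnj (row_comb y e B) * cnj (row_comb y g B))) \<le>
      ((\<Sum>b<d. cmod (x b)) * (\<Sum>b<d. cmod (x' b))) * ((\<Sum>b<d. cmod (y b)) * (\<Sum>b<d. cmod (y b)))"
    using assms norm_row_le by (intro AE_I2) (auto simp: norm_mult intro!: mult_mono sum_nonneg mult_nonneg_nonneg)
qed (use assms in measurable)

section \<open>Second and fourth moments of row combinations\<close>

definition M2 :: "(nat \<Rightarrow> complex) \<Rightarrow> (nat \<Rightarrow> complex) \<Rightarrow> nat \<Rightarrow> nat \<Rightarrow> complex" where
  "M2 x y a c = (\<integral>B. row_comb x a B * cnj (row_comb y c B) \<partial>\<mu>)"

text \<open>Both conjugated factors share the vector y, since they come from the square of one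
  quadratic form. This makes the moment symmetric in its last two indices.\<close>

definition M4 :: "(nat \<Rightarrow> complex) \<Rightarrow> (nat \<Rightarrow> complex) \<Rightarrow> (nat \<Rightarrow> complex) \<Rightarrow> nat \<Rightarrow> nat \<Rightarrow> nat \<Rightarrow> nat \<Rightarrow> complex" where
  "M4 x x' y a c e g = (\<integral>B. row_comb x a B * row_comb x' c B * (cnj (row_comb y e B) * cnj (row_comb y g B)) \<partial>\<mu>)"

lemma M2_mult:
  assumes V: "V \<in> unitary_group d" and "a < d" "c < d"
  shows "M2 x y a c = (\<integral>B. row_comb x a (V * B) * cnj (row_comb y c (V * B)) \<partial>\<mu>)"
  unfolding M2_def using assms(2,3) by (intro integral_mult_left[OF V, symmetric]) measurable

lemma M4_mult:
  assumes V: "V \<in> unitary_group d" and "a < d" "c < d" "e < d" "g < d"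
  shows "M4 x x' y a c e g = (\<integral>B. row_comb x a (V * B) * row_comb x' c (V * B) *
      (cnj (row_comb y e (V * B)) * cnj (row_comb y g (V * B))) \<partial>\<mu>)"
  unfolding M4_def using assms(2-5) by (intro integral_mult_left[OF V, symmetric]) measurable

lemma M2_invariant:
  assumes V: "V \<in> unitary_group d" and a: "a < d" "c < d" and S: "S \<subseteq> {..<d}"
    "\<And>k z. k \<in> {a, c} \<Longrightarrow> z < d \<Longrightarrow> z \<notin> S \<Longrightarrow> V $$ (k, z) = 0"
  shows "M2 x y a c = (\<Sum>z\<in>S. \<Sum>w\<in>S. V $$ (a, z) * cnj (V $$ (c, w)) * M2 x y z w)"
proof -
  have "M2 x y a c = (\<integral>B. (\<Sum>z\<in>S. \<Sum>w\<in>S. V $$ (a, z) * cnj (V $$ (c, w)) *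
      (row_comb x z B * cnj (row_comb y w B))) \<partial>\<mu>)"
    unfolding M2_mult[OF V a] using a S
    by (intro Bochner_Integration.integral_cong refl) (simp add: row_mult[OF V _ _ S(1)] sum_product mult_ac)
  also have "\<dots> = (\<Sum>z\<in>S. \<Sum>w\<in>S. V $$ (a, z) * cnj (V $$ (c, w)) * M2 x y z w)"
    unfolding M2_def using S(1)
    by (intro has_bochner_integral_integral_eq has_bochner_integral_sum has_bochner_integral_mult_right
        has_bochner_integral_integrable row_integrable2) auto
  finally show ?thesis .
qed

lemma M4_invariant:
  assumes V: "V \<in> unitary_group d" and a: "a < d" "c < d" "e < d" "g < d" and S: "S \<subseteq> {..<d}"
    "\<And>k z. k \<in> {a, c, e, g} \<Longrightarrow> z < d \<Longrightarrow> z \<notin> S \<Longrightarrow> V $$ (k, z) = 0"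
  shows "M4 x x' y a c e g = (\<Sum>z1\<in>S. \<Sum>z2\<in>S. \<Sum>z3\<in>S. \<Sum>z4\<in>S.
    V $$ (a, z1) * V $$ (c, z2) * (cnj (V $$ (e, z3)) * cnj (V $$ (g, z4))) * M4 x x' y z1 z2 z3 z4)"
proof -
  have "M4 x x' y a c e g = (\<integral>B. (\<Sum>z1\<in>S. \<Sum>z2\<in>S. \<Sum>z3\<in>S. \<Sum>z4\<in>S.
    V $$ (a, z1) * V $$ (c, z2) * (cnj (V $$ (e, z3)) * cnj (V $$ (g, z4))) *
      (row_comb x z1 B * row_comb x' z2 B * (cnj (row_comb y z3 B) * cnj (row_comb y z4 B)))) \<partial>\<mu>)"
    unfolding M4_mult[OF V a]
  proof (intro Bochner_Integration.integral_cong refl)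
    fix B assume B: "B \<in> space \<mu>"
    have "row_comb x a (V * B) * row_comb x' c (V * B) * (cnj (row_comb y e (V * B)) * cnj (row_comb y g (V * B))) =
      (\<Sum>z1\<in>S. \<Sum>z2\<in>S. (V $$ (a, z1) * row_comb x z1 B) * (V $$ (c, z2) * row_comb x' z2 B)) *
      (\<Sum>z3\<in>S. \<Sum>z4\<in>S. (cnj (V $$ (e, z3)) * cnj (row_comb y z3 B)) * (cnj (V $$ (g, z4)) * cnj (row_comb y z4 B)))"
      using a S(2) by (simp add: row_mult[OF V B _ S(1)] sum_product)
    also have "\<dots> = (\<Sum>z1\<in>S. \<Sum>z2\<in>S. \<Sum>z3\<in>S. \<Sum>z4\<in>S.
      V $$ (a, z1) * V $$ (c, z2) * (cnj (V $$ (e, z3)) * cnj (V $$ (g, z4))) *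
      (row_comb x z1 B * row_comb x' z2 B * (cnj (row_comb y z3 B) * cnj (row_comb y z4 B))))"
      unfolding sum_distrib_right unfolding sum_distrib_left by (intro sum.cong refl) (simp add: mult_ac)
    finally show "row_comb x a (V * B) * row_comb x' c (V * B) *
      (cnj (row_comb y e (V * B)) * cnj (row_comb y g (V * B))) = \<dots>" .
  qed
  also have "\<dots> = (\<Sum>z1\<in>S. \<Sum>z2\<in>S. \<Sum>z3\<in>S. \<Sum>z4\<in>S.
    V $$ (a, z1) * V $$ (c, z2) * (cnj (V $$ (e, z3)) * cnj (V $$ (g, z4))) * M4 x x' y z1 z2 z3 z4)"
    unfolding M4_def using S(1)
    by (intro has_bochner_integral_integral_eq has_bochner_integral_sum has_bochner_integral_mult_right
        has_bochner_integral_integrable row_integrable4) auto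
  finally show ?thesis .
qed

lemma row_phase_mat:
  assumes "B \<in> space \<mu>" "a < d"
  shows "row_comb x a (phase_mat d t * B) = (if a = t then \<i> else 1) * row_comb x a B"
  using assms by (subst row_mult[OF phase_mat_unitary, where S = "{a}"]) (auto simp: phase_mat_def)

lemma M2_phase:
  assumes "a < d" "c < d"
  shows "M2 x y a c = (if a = t then \<i> else 1) * cnj (if c = t then \<i> else 1) * M2 x y a c" (is "_ = ?k * _")
proof -
  have "M2 x y a c = (\<integral>B. ?k * (row_comb x a B * cnj (row_comb y c B)) \<partial>\<mu>)"
    unfolding M2_mult[OF phase_mat_unitary[of d t] assms] using assms
    by (intro Bochner_Integration.integral_cong refl) (simp only: row_phase_mat complex_cnj_mult mult_ac)
  thus ?thesis by (simp only: integral_mult_right_zero M2_def)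
qed

lemma M4_phase:
  assumes "a < d" "c < d" "e < d" "g < d"
  shows "M4 x x' y a c e g = (if a = t then \<i> else 1) * (if c = t then \<i> else 1) *
    (cnj (if e = t then \<i> else 1) * cnj (if g = t then \<i> else 1)) * M4 x x' y a c e g" (is "_ = ?k * _")
proof -
  have "M4 x x' y a c e g = (\<integral>B. ?k * (row_comb x a B * row_comb x' c B * (cnj (row_comb y e B) * cnj (row_comb y g B))) \<partial>\<mu>)"
    unfolding M4_mult[OF phase_mat_unitary[of d t] assms] using assms
    by (intro Bochner_Integration.integral_cong refl) (simp only: row_phase_mat complex_cnj_mult mult_ac)
  thus ?thesis by (simp only: integral_mult_right_zero M4_def)
qed

lemma M2_eq_0:
  assumes "a < d" "c < d" "a \<noteq> c"
  shows "M2 x y a c = 0"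
proof -
  have "M2 x y a c = \<i> * M2 x y a c" using M2_phase[OF assms(1,2), of x y a] assms(3) by simp
  thus ?thesis by (metis complex_i_not_one mult_cancel_right1)
qed

text \<open>A nonzero moment is unchanged by the phase at any row t, so t occurs equally often among
  a, c and among e, g. Taking t to be each of the four indices shows that the two multisets
  agree.\<close>

lemma M4_eq_0:
  assumes "a < d" "c < d" "e < d" "g < d" "\<not> (a = e \<and> c = g \<or> a = g \<and> c = e)"
  shows "M4 x x' y a c e g = 0"
proof (rule ccontr)
  assume "M4 x x' y a c e g \<noteq> 0"
  hence "(if a = t then \<i> else 1) * (if c = t then \<i> else 1) *
    (cnj (if e = t then \<i> else 1) * cnj (if g = t then \<i> else 1)) = 1" for t
    using M4_phase[OF assms(1-4), of x x' y t] by (metis mult_cancel_right1)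
  from this[of a] this[of c] this[of e] this[of g] assms(5) show False
    by (auto split: if_splits simp: complex_eq_iff)
qed

lemma M2_diag_eq:
  assumes "a < d" "c < d"
  shows "M2 x y a a = M2 x y c c"
proof (cases "a = c")
  case False
  have "M2 x y a a = (\<Sum>z\<in>{a, c}. \<Sum>w\<in>{a, c}. plane_rotation d a c 0 1 $$ (a, z) *
      cnj (plane_rotation d a c 0 1 $$ (a, w)) * M2 x y z w)"
    using assms False
    by (intro M2_invariant plane_rotation_unitary) (auto simp: plane_rotation_def)
  also have "\<dots> = M2 x y c c"
    using assms False by (simp add: plane_rotation_def)
  finally show ?thesis .
qed simp

text \<open>Phases remove the off-diagonal moments, exchanging rows makes the d diagonal ones equal,
  and by \<open>sum_rows\<close> they add up to <y, x>.\<close>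

lemma M2_eq:
  assumes "a < d" "c < d"
  shows "M2 x y a c = (if a = c then cdot d y x / of_nat d else 0)"
proof -
  have "has_bochner_integral \<mu> (\<lambda>B. \<Sum>z<d. row_comb x z B * cnj (row_comb y z B)) (\<Sum>z<d. M2 x y z z)"
    unfolding M2_def by (intro has_bochner_integral_sum has_bochner_integral_integrable row_integrable2) auto
  hence "(\<Sum>z<d. M2 x y z z) = (\<integral>B. (\<Sum>z<d. row_comb x z B * cnj (row_comb y z B)) \<partial>\<mu>)"
    by (simp add: has_bochner_integral_iff)
  also have "\<dots> = (\<integral>B. cdot d y x \<partial>\<mu>)"
    by (intro Bochner_Integration.integral_cong refl sum_rows)
  also have "\<dots> = cdot d y x" by (simp add: prob_space)
  also have "(\<Sum>z<d. M2 x y z z) = (\<Sum>z<d. M2 x y a a)"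
    using assms by (intro sum.cong refl M2_diag_eq) auto
  finally have "of_nat d * M2 x y a a = cdot d y x" by simp
  thus ?thesis using M2_eq_0[OF assms] dim by (auto simp: field_simps)
qed

lemma M4_swap34: "M4 x x' y a c e g = M4 x x' y a c g e"
  unfolding M4_def by (simp add: mult_ac)

text \<open>Rows a and c of the rotation vanish outside columns a and c, so the moments with all
  indices in {a, c} form a closed linear system.\<close>

lemma M4_rotated:
  assumes ac: "a < d" "c < d" "a \<noteq> c" and pq: "p\<^sup>2 + q\<^sup>2 = 1"
    and k: "k \<in> {a, c}" "l \<in> {a, c}" "k' \<in> {a, c}" "l' \<in> {a, c}"
  shows "M4 x x' y k l k' l' = (\<Sum>z1\<in>{a, c}. \<Sum>z2\<in>{a, c}. \<Sum>z3\<in>{a, c}. \<Sum>z4\<in>{a, c}.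
    plane_rotation d a c p q $$ (k, z1) * plane_rotation d a c p q $$ (l, z2) *
    (cnj (plane_rotation d a c p q $$ (k', z3)) * cnj (plane_rotation d a c p q $$ (l', z4))) *
    M4 x x' y z1 z2 z3 z4)"
proof (rule M4_invariant[OF plane_rotation_unitary[OF ac pq]])
  show "k < d" "l < d" "k' < d" "l' < d" "{a, c} \<subseteq> {..<d}" using ac k by auto
  fix i z assume "i \<in> {k, l, k', l'}" "z < d" "z \<notin> {a, c}"
  moreover from this have "i = a \<or> i = c" using k by auto
  ultimately show "plane_rotation d a c p q $$ (i, z) = 0" using ac by (auto simp: plane_rotation_def)
qed

lemma M4_diag_eq:
  assumes "a < d" "c < d"
  shows "M4 x x' y a a a a = M4 x x' y c c c c"
proof (cases "a = c")
  case False
  have "M4 x x' y a a a a = (\<Sum>z1\<in>{a, c}. \<Sum>z2\<in>{a, c}. \<Sum>z3\<in>{a, c}. \<Sum>z4\<in>{a, c}.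
    plane_rotation d a c 0 1 $$ (a, z1) * plane_rotation d a c 0 1 $$ (a, z2) *
    (cnj (plane_rotation d a c 0 1 $$ (a, z3)) * cnj (plane_rotation d a c 0 1 $$ (a, z4))) *
    M4 x x' y z1 z2 z3 z4)"
    using assms False by (intro M4_rotated) auto
  also have "\<dots> = M4 x x' y c c c c" using assms False by (simp add: plane_rotation_def)
  finally show ?thesis .
qed simp

text \<open>Under the quarter turn the sign attached to row c occurs twice and cancels.\<close>

lemma M4_swap12:
  assumes "a < d" "c < d" "a \<noteq> c"
  shows "M4 x x' y a c a c = M4 x x' y c a c a"
proof -
  have "M4 x x' y a c a c = (\<Sum>z1\<in>{a, c}. \<Sum>z2\<in>{a, c}. \<Sum>z3\<in>{a, c}. \<Sum>z4\<in>{a, c}.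
    plane_rotation d a c 0 1 $$ (a, z1) * plane_rotation d a c 0 1 $$ (c, z2) *
    (cnj (plane_rotation d a c 0 1 $$ (a, z3)) * cnj (plane_rotation d a c 0 1 $$ (c, z4))) *
    M4 x x' y z1 z2 z3 z4)"
    using assms by (intro M4_rotated) auto
  also have "\<dots> = M4 x x' y c a c a" using assms by (simp add: plane_rotation_def)
  finally show ?thesis .
qed

text \<open>Let D be the diagonal moment and M the mixed one. The rotation by (3/5, 4/5) gives D =
  (81 + 256)/625 D + 4 (144/625) M, after identifying the two diagonal and the four mixed moments by
  symmetry. Solving this yields D = 2 M.\<close>

lemma M4_diag_eq_mixed:
  assumes "a < d" "c < d" "a \<noteq> c"
  shows "M4 x x' y a a a a = 2 * M4 x x' y a c a c"
proof -
  let ?V = "plane_rotation d a c (3/5) (4/5)"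
  have V: "?V $$ (a, a) = 3/5" "?V $$ (a, c) = 4/5" using assms by (auto simp: plane_rotation_def)
  have "M4 x x' y a a a a = (\<Sum>z1\<in>{a, c}. \<Sum>z2\<in>{a, c}. \<Sum>z3\<in>{a, c}. \<Sum>z4\<in>{a, c}.
    ?V $$ (a, z1) * ?V $$ (a, z2) * (cnj (?V $$ (a, z3)) * cnj (?V $$ (a, z4))) * M4 x x' y z1 z2 z3 z4)"
    using assms by (intro M4_rotated) (auto simp: power2_eq_square)
  also have "\<dots> = 81/625 * M4 x x' y a a a a + 256/625 * M4 x x' y c c c c +
      144/625 * (M4 x x' y a c a c + M4 x x' y a c c a + M4 x x' y c a a c + M4 x x' y c a c a)"
    using assms by (simp add: V M4_eq_0 algebra_simps)
  also have "M4 x x' y a c c a = M4 x x' y a c a c" by (rule M4_swap34)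
  also have "M4 x x' y c a a c = M4 x x' y c a c a" by (rule M4_swap34)
  also have "M4 x x' y c a c a = M4 x x' y a c a c" using M4_swap12[OF assms] by simp
  also have "M4 x x' y c c c c = M4 x x' y a a a a" using M4_diag_eq[of a c x x' y] assms by simp
  finally show ?thesis by (simp add: field_simps)
qed

text \<open>Sum the mixed moments over c. Unitarity contracts the second pair and leaves <y, x'>
  times a second moment, while the d summands are D/2 each, except for D itself at c = a, so that
  the total is (d + 1) D/2.\<close>

lemma M4_diag:
  assumes a: "a < d"
  shows "M4 x x' y a a a a = 2 * cdot d y x * cdot d y x' / (of_nat d * (of_nat d + 1))"
proof -
  have "has_bochner_integral \<mu> (\<lambda>B. \<Sum>c<d. row_comb x a B * row_comb x' c B * (cnj (row_comb y a B) * cnj (row_comb y c B)))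
      (\<Sum>c<d. M4 x x' y a c a c)"
    unfolding M4_def using a
    by (intro has_bochner_integral_sum has_bochner_integral_integrable row_integrable4) auto
  hence "(\<Sum>c<d. M4 x x' y a c a c) =
      (\<integral>B. (\<Sum>c<d. row_comb x a B * row_comb x' c B * (cnj (row_comb y a B) * cnj (row_comb y c B))) \<partial>\<mu>)"
    by (simp add: has_bochner_integral_iff)
  also have "\<dots> = (\<integral>B. cdot d y x' * (row_comb x a B * cnj (row_comb y a B)) \<partial>\<mu>)"
  proof (intro Bochner_Integration.integral_cong refl)
    fix B assume B: "B \<in> space \<mu>"
    show "(\<Sum>c<d. row_comb x a B * row_comb x' c B * (cnj (row_comb y a B) * cnj (row_comb y c B))) =
        cdot d y x' * (row_comb x a B * cnj (row_comb y a B))"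
      unfolding sum_rows[OF B, symmetric] sum_distrib_right by (simp add: mult_ac)
  qed
  also have "\<dots> = cdot d y x' * M2 x y a a" by (simp add: M2_def)
  also have "\<dots> = cdot d y x * cdot d y x' / of_nat d" using a by (simp add: M2_eq)
  also have "(\<Sum>c<d. M4 x x' y a c a c) = (\<Sum>c<d. M4 x x' y a a a a / 2 + (if c = a then M4 x x' y a a a a / 2 else 0))"
    using a M4_diag_eq_mixed[of a _ x x' y] by (intro sum.cong) (auto simp: field_simps)
  also have "\<dots> = of_nat d * (M4 x x' y a a a a / 2) + M4 x x' y a a a a / 2"
    using a by (simp add: sum.distrib)
  also have "\<dots> = (of_nat d + 1) * M4 x x' y a a a a / 2" by (simp add: field_simps)
  finally have "(of_nat d + 1) * M4 x x' y a a a a = 2 * (cdot d y x * cdot d y x' / of_nat d)"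
    by simp
  hence "M4 x x' y a a a a * (of_nat d * (of_nat d + 1)) = 2 * cdot d y x * cdot d y x'"
    using dim by (simp add: field_simps)
  moreover have "of_nat (d * Suc d) \<noteq> (0 :: complex)" using dim by (subst of_nat_eq_0_iff) auto
  hence "of_nat d * (of_nat d + 1) \<noteq> (0 :: complex)"
    by (simp only: of_nat_mult of_nat_Suc add.commute not_False_eq_True)
  ultimately show ?thesis by (simp only: nonzero_eq_divide_eq not_False_eq_True)
qed

text \<open>For a = c one term survives and carries the full diagonal moment. For distinct a and c
  the two matchings survive with half of it each, so the result has the same form in both
  cases.\<close>

lemma M4_contracted:
  assumes a: "a < d" "c < d"
  shows "(\<Sum>e<d. \<Sum>g<d. y e * y g * M4 x x' y' a c e g) =
    y a * y c * (2 * cdot d y' x * cdot d y' x' / (of_nat d * (of_nat d + 1)))" (is "_ = _ * ?A")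
proof (cases "a = c")
  case True
  have "(\<Sum>e<d. \<Sum>g<d. y e * y g * M4 x x' y' a c e g) =
      (\<Sum>e<d. \<Sum>g<d. if e = a then (if g = a then y a * y a * M4 x x' y' a a a a else 0) else 0)"
    using a True by (intro sum.cong refl) (auto simp: M4_eq_0)
  also have "\<dots> = (\<Sum>e<d. if e = a then y a * y a * M4 x x' y' a a a a else 0)"
    using a by (intro sum.cong refl) simp
  finally show ?thesis using a True by (simp add: M4_diag)
next
  case False
  have A: "M4 x x' y' a c a c = ?A / 2" "M4 x x' y' a c c a = ?A / 2"
    using M4_diag_eq_mixed[OF a False, of x x' y'] M4_diag[OF a(1), of x x' y']
      M4_swap34[of x x' y' a c a c] by auto
  have "(\<Sum>e<d. \<Sum>g<d. y e * y g * M4 x x' y' a c e g) =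
      (\<Sum>e<d. \<Sum>g<d. (if e = a then if g = c then y a * y c * (?A / 2) else 0 else 0) +
        (if e = c then if g = a then y a * y c * (?A / 2) else 0 else 0))"
    using a False A by (intro sum.cong refl) (auto simp: M4_eq_0)
  also have "\<dots> = (\<Sum>e<d. (if e = a then y a * y c * (?A / 2) else 0) + (if e = c then y a * y c * (?A / 2) else 0))"
    using a by (intro sum.cong refl) (simp add: sum.distrib)
  also have "\<dots> = y a * y c * (?A / 2) + y a * y c * (?A / 2)"
    using a by (simp add: sum.distrib)
  finally show ?thesis by simp
qed

section \<open>From row combinations to matrix entries\<close>

lemma row_comb_unit:
  assumes "b < d"
  shows "row_comb (\<lambda>j. if j = b then 1 else 0) a B = B $$ (a, b)"
  using assms by (simp add: row_comb_def if_distrib cong: if_cong)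

lemma cdot_unit:
  assumes "b < d"
  shows "cdot d v (\<lambda>j. if j = b then 1 else 0) = cnj (v b)"
  using assms by (simp add: cdot_def if_distrib cong: if_cong)

lemma quad_form_rows: "quad_form d v (($$) B) = (\<Sum>e<d. cnj (v e) * row_comb v e B)"
  by (simp add: quad_form_def row_comb_def rank_one_def sum_distrib_left sum.cartesian_product
      case_prod_unfold mult_ac)

text \<open>Entries are row combinations with standard basis vectors. The contraction over row
  indices supplies the factors v a and v a', and the inner products with basis vectors supply the
  conjugated ones, together \<open>rank_one v\<close> at both positions.\<close>

lemma matrix_ensemble_haar: "matrix_ensemble \<mu> d (2 / (real d * (real d + 1)))"
proof unfold_locales
  show "d \<ge> 1" by (rule dim)
  show "space \<mu> \<subseteq> carrier_mat d d" by (auto simp: space_haar unitary_group_def)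
  show "2 / (real d * (real d + 1)) > 0" using dim by simp
next
  fix p assume "p \<in> {..<d} \<times> {..<d}"
  then obtain a b where p: "p = (a, b)" "a < d" "b < d" by auto
  show m: "(\<lambda>B. B $$ p) \<in> borel_measurable \<mu>" using p entry_measurable_haar by simp
  show "integrable \<mu> (\<lambda>B. cmod (B $$ p) ^ 4)"
  proof (rule integrable_const_bound[of _ 1])
    show "AE B in \<mu>. norm (cmod (B $$ p) ^ 4) \<le> 1"
      using p norm_unitary_entry_le_1[of _ d a b] by (intro AE_I2) (auto simp: space_haar intro!: power_le_one)
  qed (use m in measurable)
  fix q assume "q \<in> {..<d} \<times> {..<d}"
  then obtain a' b' where q: "q = (a', b')" "a' < d" "b' < d" by auto
  define x where "x = (\<lambda>j. if j = b then 1 else (0 :: complex))"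
  define x' where "x' = (\<lambda>j. if j = b' then 1 else (0 :: complex))"
  have "(\<integral>B. B $$ p * cnj (B $$ q) \<partial>\<mu>) = M2 x x' a a'"
    using p q by (simp add: M2_def x_def x'_def row_comb_unit)
  also have "\<dots> = (if p = q then 1 / of_nat d else 0)"
    using p q by (simp add: M2_eq x_def cdot_unit) (simp add: x'_def)
  finally show "(\<integral>B. B $$ p * cnj (B $$ q) \<partial>\<mu>) = (if p = q then 1 / of_nat d else 0)" .
  fix v
  have "(\<integral>B. B $$ p * B $$ q * cnj ((quad_form d v (($$) B))\<^sup>2) \<partial>\<mu>) =
      (\<integral>B. (\<Sum>e<d. \<Sum>g<d. v e * v g * (row_comb x a B * row_comb x' a' B *
        (cnj (row_comb v e B) * cnj (row_comb v g B)))) \<partial>\<mu>)"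
  proof (intro Bochner_Integration.integral_cong refl)
    fix B
    have "cnj ((quad_form d v (($$) B))\<^sup>2) = (\<Sum>e<d. \<Sum>g<d. v e * v g * (cnj (row_comb v e B) * cnj (row_comb v g B)))"
      unfolding quad_form_rows power2_eq_square complex_cnj_mult cnj_sum sum_product
      by (simp add: mult_ac)
    thus "B $$ p * B $$ q * cnj ((quad_form d v (($$) B))\<^sup>2) =
      (\<Sum>e<d. \<Sum>g<d. v e * v g * (row_comb x a B * row_comb x' a' B * (cnj (row_comb v e B) * cnj (row_comb v g B))))"
      using p q by (simp only: x_def x'_def row_comb_unit sum_distrib_left mult_ac)
  qed
  also have "\<dots> = (\<Sum>e<d. \<Sum>g<d. v e * v g * M4 x x' v a a' e g)"
    unfolding M4_def using p q
    by (intro has_bochner_integral_integral_eq has_bochner_integral_sum has_bochner_integral_mult_right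
        has_bochner_integral_integrable row_integrable4) auto
  also have "\<dots> = v a * v a' * (2 * cnj (v b) * cnj (v b') / (of_nat d * (of_nat d + 1)))"
    using p q by (simp add: M4_contracted x_def x'_def cdot_unit)
  also have "\<dots> = of_real (2 / (real d * (real d + 1))) * rank_one v p * rank_one v q"
    using p q by (simp add: rank_one_def)
  finally show "(\<integral>B. B $$ p * B $$ q * cnj ((quad_form d v (($$) B))\<^sup>2) \<partial>\<mu>) =
      of_real (2 / (real d * (real d + 1))) * rank_one v p * rank_one v q" .
qed

end

section \<open>Moments of Gaussian matrices\<close>

text \<open>For even k this is (k - 1)!! times the k-th power of the standard deviation.\<close>

definition normal_moment :: "real \<Rightarrow> nat \<Rightarrow> real" where
  "normal_moment \<sigma> k = (if even k then fact k / ((2 / \<sigma>\<^sup>2) ^ (k div 2) * fact (k div 2)) else 0)"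

lemma has_normal_moment:
  assumes "\<sigma> > 0"
  shows "has_bochner_integral (density lborel (\<lambda>x. ennreal (normal_density 0 \<sigma> x))) (\<lambda>x. x ^ k) (normal_moment \<sigma> k)"
proof (rule has_bochner_integral_density)
  show "has_bochner_integral lborel (\<lambda>x. normal_density 0 \<sigma> x *\<^sub>R x ^ k) (normal_moment \<sigma> k)"
  proof (cases "even k")
    case True
    then obtain m where "k = 2 * m" by (rule evenE)
    thus ?thesis using normal_moment_even[OF assms, of 0 m] by (simp add: normal_moment_def)
  next
    case False
    then obtain m where "k = 2 * m + 1" by (rule oddE)
    thus ?thesis using normal_moment_odd[OF assms, of 0 m] by (simp add: normal_moment_def)
  qed
qed auto

section \<open>Moments of one complex Gaussian\<close>

lemma has_bochner_integral_pair_mult: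
  fixes f g :: "'a \<Rightarrow> complex"
  assumes "prob_space M" "prob_space N"
    and f: "has_bochner_integral M f a" and g: "has_bochner_integral N g b"
  shows "has_bochner_integral (M \<Otimes>\<^sub>M N) (\<lambda>(x, y). f x * g y) (a * b)"
proof -
  interpret M: prob_space M by fact
  interpret N: prob_space N by fact
  interpret pair_sigma_finite M N ..
  have fg: "integrable M f" "integrable N g" "integral\<^sup>L M f = a" "integral\<^sup>L N g = b"
    using f g by (auto simp: has_bochner_integral_iff)
  note [measurable] = borel_measurable_integrable[OF fg(1)] borel_measurable_integrable[OF fg(2)]
  have int: "integrable (M \<Otimes>\<^sub>M N) (\<lambda>(x, y). f x * g y)"
  proof (rule Fubini_integrable)
    show "(\<lambda>(x, y). f x * g y) \<in> borel_measurable (M \<Otimes>\<^sub>M N)" by measurable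
    show "integrable M (\<lambda>x. \<integral>y. norm (case (x, y) of (x, y) \<Rightarrow> f x * g y) \<partial>N)"
      using fg by (simp add: norm_mult integrable_norm)
    show "AE x in M. integrable N (\<lambda>y. case (x, y) of (x, y) \<Rightarrow> f x * g y)"
      using fg by simp
  qed
  have "(\<integral>z. (case z of (x, y) \<Rightarrow> f x * g y) \<partial>(M \<Otimes>\<^sub>M N)) = (\<integral>x. (\<integral>y. f x * g y \<partial>N) \<partial>M)"
    using integral_fst[OF int] by simp
  also have "\<dots> = a * b" using fg by simp
  finally show ?thesis using int by (simp add: has_bochner_integral_iff)
qed

lemma borel_measurable_Complex_pair:
  assumes "sets N = sets borel"
  shows "(\<lambda>(x, y). Complex x y) \<in> borel_measurable (N \<Otimes>\<^sub>M N)"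
proof -
  have "(\<lambda>p. complex_of_real (fst p) + \<i> * complex_of_real (snd p)) \<in> borel_measurable (borel \<Otimes>\<^sub>M borel)"
    by measurable
  moreover have "sets (N \<Otimes>\<^sub>M N) = sets (borel \<Otimes>\<^sub>M borel)" using assms by (intro sets_pair_measure_cong)
  ultimately show ?thesis
    by (simp add: case_prod_unfold Complex_eq cong: measurable_cong_sets)
qed

lemma complex_gaussian_eq:
  "complex_gaussian v = distr (density lborel (\<lambda>x. ennreal (normal_density 0 (sqrt (v / 2)) x)) \<Otimes>\<^sub>M
     density lborel (\<lambda>x. ennreal (normal_density 0 (sqrt (v / 2)) x))) borel (\<lambda>(x, y). Complex x y)"
  by (simp add: complex_gaussian_def Let_def)

lemma prob_space_complex_gaussian:
  assumes "v > 0"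
  shows "prob_space (complex_gaussian v)"
proof -
  let ?N = "density lborel (\<lambda>x. ennreal (normal_density 0 (sqrt (v / 2)) x))"
  interpret N: prob_space ?N using assms by (intro prob_space_normal_density) auto
  interpret pair_prob_space ?N ?N ..
  show ?thesis unfolding complex_gaussian_eq
    by (intro prob_space_distr borel_measurable_Complex_pair) simp
qed

lemma sets_complex_gaussian [simp]: "sets (complex_gaussian v) = sets borel"
  by (simp add: complex_gaussian_eq)

text \<open>Both powers are expanded binomially in the independent real and imaginary parts, of
  variance v/2 each. Exponents up to 2 suffice for fourth moments of the matrix, which leaves nine
  cases to evaluate.\<close>

lemma has_complex_gaussian_moment:
  assumes v: "v > 0" and jk: "j \<le> 2" "k \<le> 2"
  shows "has_bochner_integral (complex_gaussian v) (\<lambda>z. z ^ j * cnj z ^ k)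
    (if j = k then fact j * of_real v ^ j else 0)"
  unfolding complex_gaussian_eq
proof (rule has_bochner_integral_distr)
  let ?\<sigma> = "sqrt (v / 2)"
  let ?N = "density lborel (\<lambda>x. ennreal (normal_density 0 ?\<sigma> x))"
  let ?m = "\<lambda>k. complex_of_real (normal_moment ?\<sigma> k)"
  have ps: "prob_space ?N" using v by (intro prob_space_normal_density) auto
  show "(\<lambda>z. z ^ j * cnj z ^ k) \<in> borel_measurable borel" by measurable
  show "(\<lambda>(x, y). Complex x y) \<in> borel_measurable (?N \<Otimes>\<^sub>M ?N)"
    by (rule borel_measurable_Complex_pair) simp
  have m: "has_bochner_integral ?N (\<lambda>x. complex_of_real x ^ i) (?m i)" for i
    using has_normal_moment[of ?\<sigma> i] v
    by (simp add: has_bochner_integral_iff flip: of_real_power)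
  let ?c = "\<lambda>a b. of_nat (j choose a) * of_nat (k choose b) * \<i> ^ (j - a) * (- \<i>) ^ (k - b)"
  have "has_bochner_integral (?N \<Otimes>\<^sub>M ?N)
      (\<lambda>z. \<Sum>a\<le>j. \<Sum>b\<le>k. ?c a b * (case z of (x, y) \<Rightarrow> complex_of_real x ^ (a + b) * complex_of_real y ^ ((j - a) + (k - b))))
      (\<Sum>a\<le>j. \<Sum>b\<le>k. ?c a b * (?m (a + b) * ?m ((j - a) + (k - b))))"
    by (intro has_bochner_integral_sum has_bochner_integral_mult_right has_bochner_integral_pair_mult ps m)
  also have "(\<lambda>z. \<Sum>a\<le>j. \<Sum>b\<le>k. ?c a b * (case z of (x, y) \<Rightarrow> complex_of_real x ^ (a + b) * complex_of_real y ^ ((j - a) + (k - b))))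
      = (\<lambda>z. (case z of (x, y) \<Rightarrow> Complex x y) ^ j * cnj (case z of (x, y) \<Rightarrow> Complex x y) ^ k)"
  proof
    fix z :: "real \<times> real"
    obtain x y where z: "z = (x, y)" by (cases z)
    have "Complex x y ^ j * cnj (Complex x y) ^ k = (of_real x + \<i> * of_real y) ^ j * (of_real x + (- \<i>) * of_real y) ^ k"
      by (simp add: Complex_eq)
    also have "\<dots> = (\<Sum>a\<le>j. \<Sum>b\<le>k. ?c a b * (complex_of_real x ^ (a + b) * complex_of_real y ^ ((j - a) + (k - b))))"
      unfolding binomial_ring sum_product power_mult_distrib
      by (intro sum.cong refl) (simp only: power_add mult_ac)
    finally show "(\<Sum>a\<le>j. \<Sum>b\<le>k. ?c a b * (case z of (x, y) \<Rightarrow> complex_of_real x ^ (a + b) * complex_of_real y ^ ((j - a) + (k - b))))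
      = (case z of (x, y) \<Rightarrow> Complex x y) ^ j * cnj (case z of (x, y) \<Rightarrow> Complex x y) ^ k"
      by (simp add: z)
  qed
  also have "(\<Sum>a\<le>j. \<Sum>b\<le>k. ?c a b * (?m (a + b) * ?m ((j - a) + (k - b)))) =
      (if j = k then fact j * of_real v ^ j else 0)"
  proof -
    have mom: "normal_moment ?\<sigma> 0 = 1" "normal_moment ?\<sigma> (Suc 0) = 0" "normal_moment ?\<sigma> 2 = v / 2"
      "normal_moment ?\<sigma> 3 = 0" "normal_moment ?\<sigma> 4 = 3 * v\<^sup>2 / 4"
      using v by (simp_all add: normal_moment_def fact_numeral power2_eq_square)
    have suc: "2 = Suc (Suc 0)" "3 = Suc (Suc (Suc 0))" "4 = Suc (Suc (Suc (Suc 0)))" by simp_all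
    have "j = 0 \<or> j = 1 \<or> j = 2" "k = 0 \<or> k = 1 \<or> k = 2" using jk by auto
    thus ?thesis
      by (elim disjE) (simp_all add: mom mom[unfolded suc] atMost_nat_numeral atMost_Suc binomial_eq_0 numeral_2_eq_2 numeral_3_eq_3
         power2_eq_square field_simps)
  qed
  finally show "has_bochner_integral (?N \<Otimes>\<^sub>M ?N) (\<lambda>z. (case z of (x, y) \<Rightarrow> Complex x y) ^ j *
      cnj (case z of (x, y) \<Rightarrow> Complex x y) ^ k) (if j = k then fact j * of_real v ^ j else 0)" .
qed

section \<open>Matrices with independent Gaussian entries\<close>

locale gaussian_matrices =
  fixes d :: nat
  assumes dim: "d \<ge> 1"
begin

abbreviation "E \<equiv> {..<d} \<times> {..<d}"

abbreviation "g \<equiv> complex_gaussian (1 / real d)"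

definition mom :: "nat \<Rightarrow> nat \<Rightarrow> complex" where
  "mom j k = (if j = k then fact j / of_nat d ^ j else 0)"

sublocale g: prob_space g using dim by (intro prob_space_complex_gaussian) auto

sublocale G: product_prob_space "\<lambda>_. g" E ..

lemma mat_measurable: "(\<lambda>f. mat d d f) \<in> measurable (\<Pi>\<^sub>M ij\<in>E. g) (borel_mat d)"
proof (rule measurable_borel_matI)
  fix p assume p: "p \<in> E"
  have "(\<lambda>f. f p) \<in> measurable (\<Pi>\<^sub>M ij\<in>E. g) g" using p by (rule measurable_component_singleton)
  hence "(\<lambda>f. f p) \<in> borel_measurable (\<Pi>\<^sub>M ij\<in>E. g)" by (simp add: measurable_cong_sets[OF refl sets_complex_gaussian])
  moreover have "(\<lambda>f. mat d d f $$ p) = (\<lambda>f :: nat \<times> nat \<Rightarrow> complex. f p)" using p by (intro ext) auto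
  ultimately show "(\<lambda>f. mat d d f $$ p) \<in> borel_measurable (\<Pi>\<^sub>M ij\<in>E. g)" by (simp only:)
qed auto

lemma prob_space_gaussian_mat: "prob_space (gaussian_mat d)"
  unfolding gaussian_mat_def 
  by (intro prob_space.prob_space_distr prob_space_PiM mat_measurable g.prob_space_axioms)

lemma entry_measurable_gaussian:
  assumes "p \<in> E"
  shows "(\<lambda>B. B $$ p) \<in> borel_measurable (gaussian_mat d)"
  using entry_measurable_borel_mat[OF assms] by (simp add: gaussian_mat_def)

text \<open>Writing a monomial by its exponents at every entry treats coinciding and distinct
  entries alike; independence then factors the integral over the entries.\<close>

lemma has_monomial_moment:
  assumes "\<And>r. r \<in> E \<Longrightarrow> j r \<le> 2" "\<And>r. r \<in> E \<Longrightarrow> k r \<le> 2"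
  shows "has_bochner_integral (gaussian_mat d) (\<lambda>B. \<Prod>r\<in>E. (B $$ r) ^ j r * cnj (B $$ r) ^ k r) (\<Prod>r\<in>E. mom (j r) (k r))"
  unfolding gaussian_mat_def
proof (rule has_bochner_integral_distr[OF _ mat_measurable])
  note [measurable] = entry_measurable_borel_mat
  show "(\<lambda>B. \<Prod>r\<in>E. (B $$ r) ^ j r * cnj (B $$ r) ^ k r) \<in> borel_measurable (borel_mat d)"
    by measurable
  have g: "integrable g (\<lambda>z. z ^ j r * cnj z ^ k r)" "(\<integral>z. z ^ j r * cnj z ^ k r \<partial>g) = mom (j r) (k r)"
    if "r \<in> E" for r
    using has_complex_gaussian_moment[of "1 / real d" "j r" "k r"] assms[OF that] dim
    by (auto simp: has_bochner_integral_iff mom_def power_divide split: if_splits)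
  have "has_bochner_integral (\<Pi>\<^sub>M ij\<in>E. g) (\<lambda>f. \<Prod>r\<in>E. f r ^ j r * cnj (f r) ^ k r) (\<Prod>r\<in>E. mom (j r) (k r))"
    using G.product_integrable_prod[of E "\<lambda>r z. z ^ j r * cnj z ^ k r"]
      G.product_integral_prod[of E "\<lambda>r z. z ^ j r * cnj z ^ k r"] g
    by (simp add: has_bochner_integral_iff)
  also have "(\<lambda>f. \<Prod>r\<in>E. f r ^ j r * cnj (f r) ^ k r) = (\<lambda>f. \<Prod>r\<in>E. (mat d d f $$ r) ^ j r * cnj (mat d d f $$ r) ^ k r)"
    by (intro ext prod.cong refl) auto
  finally show "has_bochner_integral (\<Pi>\<^sub>M ij\<in>E. g) (\<lambda>f. \<Prod>r\<in>E. (mat d d f $$ r) ^ j r * cnj (mat d d f $$ r) ^ k r)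
    (\<Prod>r\<in>E. mom (j r) (k r))" .
qed

lemma prod_power_of_bool:
  fixes f :: "nat \<times> nat \<Rightarrow> complex"
  assumes "p \<in> E"
  shows "(\<Prod>r\<in>E. f r ^ of_bool (r = p)) = f p"
proof -
  have "(\<Prod>r\<in>E. f r ^ of_bool (r = p)) = (\<Prod>r\<in>E. if r = p then f r else 1)"
    by (intro prod.cong) auto
  thus ?thesis using assms by simp
qed

lemma has_second_gaussian_moment:
  assumes "p \<in> E" "q \<in> E"
  shows "has_bochner_integral (gaussian_mat d) (\<lambda>B. B $$ p * cnj (B $$ q)) (if p = q then 1 / of_nat d else 0)"
proof -
  have "has_bochner_integral (gaussian_mat d)
    (\<lambda>B. \<Prod>r\<in>E. (B $$ r) ^ of_bool (r = p) * cnj (B $$ r) ^ of_bool (r = q)) (\<Prod>r\<in>E. mom (of_bool (r = p)) (of_bool (r = q)))"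
    by (rule has_monomial_moment) auto
  also have "(\<lambda>B. \<Prod>r\<in>E. (B $$ r) ^ of_bool (r = p) * cnj (B $$ r) ^ of_bool (r = q)) = (\<lambda>B. B $$ p * cnj (B $$ q))"
    using prod_power_of_bool[OF assms(1), of "\<lambda>r. _ $$ r"] prod_power_of_bool[OF assms(2), of "\<lambda>r. cnj (_ $$ r)"]
    by (simp add: prod.distrib)
  also have "(\<Prod>r\<in>E. mom (of_bool (r = p)) (of_bool (r = q))) = (if p = q then 1 / of_nat d else 0)"
  proof (cases "p = q")
    case True
    have "(\<Prod>r\<in>E. mom (of_bool (r = p)) (of_bool (r = q))) = (\<Prod>r\<in>E. if r = p then 1 / of_nat d else 1)"
      by (intro prod.cong) (auto simp: mom_def True)
    thus ?thesis using assms True by simp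
  next
    case False
    hence "(\<Prod>r\<in>E. mom (of_bool (r = p)) (of_bool (r = q))) = 0"
      using assms(1) by (intro prod_zero) (auto intro!: bexI[of _ p] simp: mom_def)
    thus ?thesis using False by simp
  qed
  finally show ?thesis .
qed

text \<open>This is Wick's formula for two plain and two conjugated factors. If the multisets {p, q}
  and {r, s} differ, some entry has unequal exponents and its moment vanishes. If they agree and p =
  q, both pairings hold, in accordance with 2! in the moment of that entry.\<close>

lemma prod_mom_pairs:
  assumes "p \<in> E" "q \<in> E" "r \<in> E" "s \<in> E"
  shows "(\<Prod>t\<in>E. mom (of_bool (t = p) + of_bool (t = q)) (of_bool (t = r) + of_bool (t = s))) =
    (of_bool (p = r \<and> q = s) + of_bool (p = s \<and> q = r)) / of_nat d ^ 2"
proof (cases "p = r \<and> q = s \<or> p = s \<and> q = r")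
  case True
  have "(\<Prod>t\<in>E. mom (of_bool (t = p) + of_bool (t = q)) (of_bool (t = r) + of_bool (t = s))) =
      (\<Prod>t\<in>E. (if t = p then 1 / of_nat d else 1) * (if t = q then (if p = q then 2 else 1) / of_nat d else 1))"
    using True by (intro prod.cong) (auto simp: mom_def power2_eq_square)
  also have "\<dots> = (if p = q then 2 else 1) / of_nat d ^ 2"
    using assms by (simp add: prod.distrib power2_eq_square)
  finally show ?thesis using True by auto
next
  case False
  hence "\<exists>t\<in>{p, q, r, s}. of_bool (t = p) + of_bool (t = q) \<noteq> (of_bool (t = r) + of_bool (t = s) :: nat)"
    by (cases "p = q"; cases "r = s"; cases "p = r"; cases "p = s"; cases "q = r"; cases "q = s") auto
  then obtain t where "t \<in> {p, q, r, s}"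
    "of_bool (t = p) + of_bool (t = q) \<noteq> (of_bool (t = r) + of_bool (t = s) :: nat)" by blast
  hence "t \<in> E" "mom (of_bool (t = p) + of_bool (t = q)) (of_bool (t = r) + of_bool (t = s)) = 0"
    using assms by (auto simp: mom_def)
  hence "(\<Prod>t\<in>E. mom (of_bool (t = p) + of_bool (t = q)) (of_bool (t = r) + of_bool (t = s))) = 0"
    by (intro prod_zero bexI[of _ t]; (assumption | simp))
  moreover have "of_bool (p = r \<and> q = s) = (0 :: complex)" "of_bool (p = s \<and> q = r) = (0 :: complex)"
    using False by simp_all
  ultimately show ?thesis by (simp only: add_0 div_0)
qed

lemma has_fourth_gaussian_moment:
  assumes "p \<in> E" "q \<in> E" "r \<in> E" "s \<in> E"
  shows "has_bochner_integral (gaussian_mat d) (\<lambda>B. B $$ p * B $$ q * (cnj (B $$ r) * cnj (B $$ s)))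
    ((of_bool (p = r \<and> q = s) + of_bool (p = s \<and> q = r)) / of_nat d ^ 2)"
proof -
  have "has_bochner_integral (gaussian_mat d)
    (\<lambda>B. \<Prod>t\<in>E. (B $$ t) ^ (of_bool (t = p) + of_bool (t = q)) * cnj (B $$ t) ^ (of_bool (t = r) + of_bool (t = s)))
    (\<Prod>t\<in>E. mom (of_bool (t = p) + of_bool (t = q)) (of_bool (t = r) + of_bool (t = s)))"
    by (rule has_monomial_moment) auto
  also have "(\<lambda>B. \<Prod>t\<in>E. (B $$ t) ^ (of_bool (t = p) + of_bool (t = q)) * cnj (B $$ t) ^ (of_bool (t = r) + of_bool (t = s)))
     = (\<lambda>B. B $$ p * B $$ q * (cnj (B $$ r) * cnj (B $$ s)))"
    unfolding power_add prod.distrib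
    using prod_power_of_bool[OF assms(1), of "\<lambda>r. _ $$ r"] prod_power_of_bool[OF assms(2), of "\<lambda>r. _ $$ r"]
      prod_power_of_bool[OF assms(3), of "\<lambda>r. cnj (_ $$ r)"] prod_power_of_bool[OF assms(4), of "\<lambda>r. cnj (_ $$ r)"]
    by simp
  finally show ?thesis unfolding prod_mom_pairs[OF assms] .
qed

text \<open>The two Wick pairings match (p, q) with (r, s) or (s, r). The weights from the squared
  quadratic form are symmetric in r and s, so the two contributions are equal and \<kappa> has the
  numerator 2.\<close>

lemma matrix_ensemble_gaussian: "matrix_ensemble (gaussian_mat d) d (2 / real d ^ 2)"
proof -
  interpret prob_space "gaussian_mat d" by (rule prob_space_gaussian_mat)
  show ?thesis
  proof unfold_locales
    show "d \<ge> 1" "2 / real d ^ 2 > 0" using dim by auto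
    show "space (gaussian_mat d) \<subseteq> carrier_mat d d" by (simp add: gaussian_mat_def)
  next
    fix p assume p: "p \<in> E"
    thus "(\<lambda>B. B $$ p) \<in> borel_measurable (gaussian_mat d)" by (rule entry_measurable_gaussian)
    have "integrable (gaussian_mat d) (\<lambda>B. B $$ p * B $$ p * (cnj (B $$ p) * cnj (B $$ p)))"
      using has_fourth_gaussian_moment[OF p p p p] by (simp add: has_bochner_integral_iff)
    also have "(\<lambda>B. B $$ p * B $$ p * (cnj (B $$ p) * cnj (B $$ p))) = (\<lambda>B. of_real (cmod (B $$ p) ^ 4))"
    proof
      fix B :: "complex mat"
      have "B $$ p * B $$ p * (cnj (B $$ p) * cnj (B $$ p)) = (B $$ p * cnj (B $$ p))\<^sup>2" by (simp add: power2_eq_square)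
      thus "B $$ p * B $$ p * (cnj (B $$ p) * cnj (B $$ p)) = of_real (cmod (B $$ p) ^ 4)"
        unfolding complex_norm_square[symmetric] by (simp add: power_mult[symmetric])
    qed
    finally show "integrable (gaussian_mat d) (\<lambda>B. cmod (B $$ p) ^ 4)"
      by (simp only: complex_of_real_integrable_eq)
    fix q assume q: "q \<in> E"
    show "(\<integral>B. B $$ p * cnj (B $$ q) \<partial>gaussian_mat d) = (if p = q then 1 / of_nat d else 0)"
      using has_second_gaussian_moment[OF p q] by (rule has_bochner_integral_integral_eq)
    fix v
    have "(\<integral>B. B $$ p * B $$ q * cnj ((quad_form d v (($$) B))\<^sup>2) \<partial>gaussian_mat d) =
      (\<integral>B. (\<Sum>r\<in>E. \<Sum>s\<in>E. rank_one v r * rank_one v s * (B $$ p * B $$ q * (cnj (B $$ r) * cnj (B $$ s)))) \<partial>gaussian_mat d)"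
    proof (intro Bochner_Integration.integral_cong refl)
      fix B :: "complex mat"
      have "cnj ((quad_form d v (($$) B))\<^sup>2) = (\<Sum>r\<in>E. \<Sum>s\<in>E. rank_one v r * rank_one v s * (cnj (B $$ r) * cnj (B $$ s)))"
        unfolding quad_form_square cnj_sum by simp
      thus "B $$ p * B $$ q * cnj ((quad_form d v (($$) B))\<^sup>2) = (\<Sum>r\<in>E. \<Sum>s\<in>E.
          rank_one v r * rank_one v s * (B $$ p * B $$ q * (cnj (B $$ r) * cnj (B $$ s))))"
        by (simp only: sum_distrib_left mult_ac)
    qed
    also have "\<dots> = (\<Sum>r\<in>E. \<Sum>s\<in>E. rank_one v r * rank_one v s *
        ((of_bool (p = r \<and> q = s) + of_bool (p = s \<and> q = r)) / of_nat d ^ 2))"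
      using p q
      by (intro has_bochner_integral_integral_eq has_bochner_integral_sum has_bochner_integral_mult_right
          has_fourth_gaussian_moment)
    also have "\<dots> = (\<Sum>r\<in>E. \<Sum>s\<in>E. (if r = p then if s = q then rank_one v p * rank_one v q / of_nat d ^ 2 else 0 else 0) +
        (if r = q then if s = p then rank_one v p * rank_one v q / of_nat d ^ 2 else 0 else 0))"
      by (intro sum.cong refl) auto
    also have "\<dots> = (\<Sum>r\<in>E. (if r = p then rank_one v p * rank_one v q / of_nat d ^ 2 else 0) +
        (if r = q then rank_one v p * rank_one v q / of_nat d ^ 2 else 0))"
      using p q by (intro sum.cong refl) (simp add: sum.distrib)
    also have "\<dots> = of_real (2 / real d ^ 2) * rank_one v p * rank_one v q"
      using p q by (simp add: sum.distrib)
    finally show "(\<integral>B. B $$ p * B $$ q * cnj ((quad_form d v (($$) B))\<^sup>2) \<partial>gaussian_mat d) =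
      of_real (2 / real d ^ 2) * rank_one v p * rank_one v q" .
  qed
qed

end

section \<open>The moment ratio\<close>

text \<open>The grid with K about sqrt n has at least (n/4)^(d - 1) points, which bounds the second
  moment from below; the first moment is of order at most n^(d - 1)/d^n. The quotient of the bounds
  is (\<kappa> d^2)^n/n^(d - 1) up to a constant, stronger than claimed by a factor n.\<close>

lemma moment_ratio_bigomega:
  assumes "matrix_ensemble \<mu> d \<kappa>" and iid: "\<And>n. iid_matrices (P n) \<mu> n (\<rho> n)"
  shows "(\<lambda>n. moment_ratio (P n) d n (1\<^sub>m n) (\<rho> n)) \<in> \<Omega>(\<lambda>n. (\<kappa> * real d ^ 2) ^ n / real n ^ d)"
proof -
  interpret matrix_ensemble \<mu> d \<kappa> by fact
  obtain C where C: "C > 0" and grid: "\<And>K n. 1 \<le> K \<Longrightarrow> K\<^sup>2 \<le> n \<Longrightarrow> \<exists>v. (\<forall>k\<in>grid d K. cdot d (v k) (v k) = 1) \<and>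
      (\<forall>k\<in>grid d K. (\<Sum>l\<in>grid d K. cmod (cdot d (v k) (v l)) ^ (4 * n)) \<le> C)"
    using nearly_orthogonal_grid[OF dim_pos] by blast
  \<comment> \<open>C bounds the overlaps and d^2 comes from the squared first moment. Of the base
    16, one factor 4 comes from the n/4 in the size of the grid, the other from squaring the
    estimate n + 1 \<le> 2 n.\<close>
  define c where "c = 1 / (C * real d ^ 2 * 16 ^ (d - 1))"
  show ?thesis
  proof (rule landau_omega.bigI)
    show "c > 0" using C dim_pos by (simp add: c_def)
    show "\<forall>\<^sub>F n in sequentially. norm (moment_ratio (P n) d n (1\<^sub>m n) (\<rho> n)) \<ge>
        c * norm ((\<kappa> * real d ^ 2) ^ n / real n ^ d)"
      using eventually_gt_at_top[of 0]
    proof eventually_elim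
      case (elim n)
      interpret iid_ensemble \<mu> d \<kappa> "P n" n "\<rho> n"
        by unfold_locales (use iid elim in auto)
      \<comment> \<open>The finest grid that satisfies K^2 \<le> n. As K \<ge> 1, also sqrt n < K +
        1 \<le> 2 K.\<close>
      define K where "K = nat \<lfloor>sqrt (real n)\<rfloor>"
      have "1 \<le> sqrt (real n)" using elim by simp
      hence K: "1 \<le> K" "real K \<le> sqrt (real n)" "sqrt (real n) < real K + 1"
        unfolding K_def by linarith+
      have "(real K)\<^sup>2 \<le> (sqrt (real n))\<^sup>2" using K(2) by (rule power_mono) simp
      hence K2: "K\<^sup>2 \<le> n" by (simp flip: of_nat_power)
      have "(sqrt (real n))\<^sup>2 \<le> (2 * real K)\<^sup>2" using K by (intro power_mono) auto
      hence Kn: "real n / 4 \<le> real K ^ 2" by (simp add: power2_eq_square)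
      obtain v where v: "\<forall>k\<in>grid d K. cdot d (v k) (v k) = 1"
        "\<forall>k\<in>grid d K. (\<Sum>l\<in>grid d K. cmod (cdot d (v k) (v l)) ^ (4 * n)) \<le> C"
        using grid[OF K(1) K2] by blast
      define m1 where "m1 = (\<integral>\<omega>. X_s d n (1\<^sub>m n) (\<lambda>ij. \<rho> n ij \<omega>) \<partial>P n)"
      define m2 where "m2 = (\<integral>\<omega>. (X_s d n (1\<^sub>m n) (\<lambda>ij. \<rho> n ij \<omega>))\<^sup>2 \<partial>P n)"
      have "\<kappa> ^ n * (real n / 4) ^ (d - 1) / C \<le> \<kappa> ^ n * (real K ^ 2) ^ (d - 1) / C"
        using Kn kappa_pos C by (intro divide_right_mono mult_left_mono power_mono) auto
      also have "\<dots> = \<kappa> ^ n * card (grid d K) / C" unfolding card_grid by (simp add: power_mult)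
      also have "\<dots> \<le> m2"
        unfolding m2_def using v C by (intro expectation_X_s_squared_ge finite_grid) auto
      finally have m2: "\<kappa> ^ n * (real n / 4) ^ (d - 1) / C \<le> m2" .
      have "m1 \<le> real d * (real n + 1) ^ (d - 1) / real d ^ n" unfolding m1_def by (rule expectation_X_s_le)
      also have "\<dots> \<le> real d * (2 * real n) ^ (d - 1) / real d ^ n"
        using elim by (intro divide_right_mono mult_left_mono power_mono) auto
      finally have "m1\<^sup>2 \<le> (real d * (2 * real n) ^ (d - 1) / real d ^ n)\<^sup>2"
        using expectation_X_s_pos by (intro power_mono) (auto simp: m1_def)
      also have "\<dots> = real d ^ 2 * 4 ^ (d - 1) * (real n ^ (d - 1)) ^ 2 / (real d ^ 2) ^ n"
        by (simp add: power_mult_distrib power_divide mult_ac flip: power_mult) (simp add: power_mult)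
      finally have m1: "m1\<^sup>2 \<le> real d ^ 2 * 4 ^ (d - 1) * (real n ^ (d - 1)) ^ 2 / (real d ^ 2) ^ n" .
      have m1_pos: "m1\<^sup>2 > 0" using expectation_X_s_pos by (simp add: m1_def)
      \<comment> \<open>The surplus factor n is given up here.\<close>
      have "c * ((\<kappa> * real d ^ 2) ^ n / real n ^ d) \<le> c * ((\<kappa> * real d ^ 2) ^ n / real n ^ (d - 1))"
        using elim kappa_pos C
        by (intro mult_left_mono divide_left_mono power_increasing mult_pos_pos) (auto simp: c_def)
      also have "\<dots> = (\<kappa> ^ n * (real n / 4) ^ (d - 1) / C) /
          (real d ^ 2 * 4 ^ (d - 1) * (real n ^ (d - 1)) ^ 2 / (real d ^ 2) ^ n)"
      proof -
        have "(16::real) ^ (d - 1) = 4 ^ (d - 1) * 4 ^ (d - 1)" by (simp flip: power_mult_distrib)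
        thus ?thesis using elim C dim_pos
          by (simp add: c_def power_mult_distrib power_divide power2_eq_square divide_simps)
      qed
      also have "\<dots> \<le> m2 / m1\<^sup>2"
        using m1 m2 m1_pos C kappa_pos by (intro frac_le) (auto intro: order.trans[rotated])
      also have "\<dots> = moment_ratio (P n) d n (1\<^sub>m n) (\<rho> n)" by (simp add: moment_ratio_def m1_def m2_def)
      finally show ?case using kappa_pos by (simp add: abs_mult)
    qed
  qed
qed

theorem theorem2:
  shows
    "(\<forall>d\<ge>1. \<forall>(P :: nat \<Rightarrow> 'a measure) \<rho>.
        (\<forall>n. iid_matrices (P n) (gaussian_mat d) n (\<rho> n)) \<longrightarrow>
        (\<lambda>n. moment_ratio (P n) d n (1\<^sub>m n) (\<rho> n)) \<in> \<Omega>(\<lambda>n. 2 ^ n / real n ^ d))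
     \<and>
     (\<exists>\<epsilon> :: nat \<Rightarrow> real. \<epsilon> \<in> O(\<lambda>d. 1 / real d) \<and> (\<forall>d\<ge>1. 0 \<le> \<epsilon> d \<and> \<epsilon> d < 1) \<and>
       (\<forall>d\<ge>1. \<forall>\<mu> (P :: nat \<Rightarrow> 'a measure) \<rho>.
          haar_unitary d \<mu> \<and> (\<forall>n. iid_matrices (P n) \<mu> n (\<rho> n)) \<longrightarrow>
          (\<lambda>n. moment_ratio (P n) d n (1\<^sub>m n) (\<rho> n))
            \<in> \<Omega>(\<lambda>n. (1 - \<epsilon> d) ^ n * (2 ^ n / real n ^ d))))"
\<comment> \<open>The witness is read off from the Haar value \<kappa> d^2 = 2 d/(d + 1) = 2 (1 -
  1/(d + 1)).\<close>
proof (intro conjI allI impI exI[of _ "\<lambda>d. 1 / (real d + 1)"])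
  fix d :: nat and P :: "nat \<Rightarrow> 'a measure" and \<rho>
  assume d: "d \<ge> 1" and iid: "\<forall>n. iid_matrices (P n) (gaussian_mat d) n (\<rho> n)"
  have "matrix_ensemble (gaussian_mat d) d (2 / real d ^ 2)"
    by (rule gaussian_matrices.matrix_ensemble_gaussian) (unfold_locales, rule d)
  from moment_ratio_bigomega[OF this, of P \<rho>] iid d
  show "(\<lambda>n. moment_ratio (P n) d n (1\<^sub>m n) (\<rho> n)) \<in> \<Omega>(\<lambda>n. 2 ^ n / real n ^ d)" by simp
next
  show "(\<lambda>d. 1 / (real d + 1)) \<in> O(\<lambda>d. 1 / real d)"
    by (intro landau_o.bigI[of 1] eventually_mono[OF eventually_gt_at_top[of 0]]) (auto simp: field_simps)
next
  fix d :: nat and \<mu> and P :: "nat \<Rightarrow> 'a measure" and \<rho>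
  assume d: "d \<ge> 1" and h: "haar_unitary d \<mu> \<and> (\<forall>n. iid_matrices (P n) \<mu> n (\<rho> n))"
  have "matrix_ensemble \<mu> d (2 / (real d * (real d + 1)))"
    by (rule haar_measure.matrix_ensemble_haar) (unfold_locales, use d h in auto)
  from moment_ratio_bigomega[OF this, of P \<rho>] h
  have "(\<lambda>n. moment_ratio (P n) d n (1\<^sub>m n) (\<rho> n)) \<in>
      \<Omega>(\<lambda>n. (2 / (real d * (real d + 1)) * real d ^ 2) ^ n / real n ^ d)" by blast
  also have "2 / (real d * (real d + 1)) * real d ^ 2 = (1 - 1 / (real d + 1)) * 2"
  proof -
    have "real d > 0" "real d + 1 > 0" using d by auto
    thus ?thesis by (simp add: divide_simps power2_eq_square)
  qed
  finally show "(\<lambda>n. moment_ratio (P n) d n (1\<^sub>m n) (\<rho> n)) \<in>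
      \<Omega>(\<lambda>n. (1 - 1 / (real d + 1)) ^ n * (2 ^ n / real n ^ d))"
    by (simp only: power_mult_distrib times_divide_eq_right)
qed auto

end
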